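(* For any $N>0$, there are cubic Perron numbers (Perron numbers of algebraic degree $3$ over $\mathbb{Q}$) whose Perron-Frobenius degrees are larger than $N$.
   Context: A real algebraic integer $p\geq 1$ is called a Perron number if it is strictly greater than the absolute value of each of its other Galois conjugates (over $\mathbb{Q}$). A non-negative integral square matrix $A$ is called aperiodic if some power of $A$ has strictly positive entries. By a theorem of Lind, every Perron number is the spectral radius of some non-negative, integral, aperiodic matrix. The Perron-Frobenius degree $d_{PF}(p)$ of a Perron number $p$ is the smallest $n$ such that there is an $n\times n$ non-negative, integral, aperiodic matrix with spectral radius equal to $p$. *)

theory Defs
  imports
    "HOL-Computational_Algebra.Polynomial"
    "Jordan_Normal_Form.Spectral_Radius"
begin

section \<open>Galois conjugates over the rationals\<close>

definition is_min_poly :: "'a :: field_char_0 \<Rightarrow> rat poly \<Rightarrow> bool" where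
  "is_min_poly x f \<longleftrightarrow> lead_coeff f = 1 \<and> irreducible f \<and> poly (map_poly of_rat f) x = 0"

text \<open>Meaningful for algebraic x only; see \<open>ex1_min_poly\<close>.\<close>

definition min_poly :: "'a :: field_char_0 \<Rightarrow> rat poly" where
  "min_poly x = (THE f. is_min_poly x f)"

definition algebraic_degree :: "'a :: field_char_0 \<Rightarrow> nat" where
  "algebraic_degree x = degree (min_poly x)"

text \<open>All complex conjugates of a real number, including the number itself.\<close>

definition galois_conjugates :: "real \<Rightarrow> complex set" where
  "galois_conjugates x = {z. poly (map_poly of_rat (min_poly x)) z = 0}"

lemma map_poly_of_rat_add:
  "map_poly (of_rat :: rat \<Rightarrow> 'a :: field_char_0) (f + g) = map_poly of_rat f + map_poly of_rat g"
  by (intro poly_eqI) (simp add: coeff_map_poly of_rat_add)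

lemma map_poly_of_rat_mult:
  "map_poly (of_rat :: rat \<Rightarrow> 'a :: field_char_0) (f * g) = map_poly of_rat f * map_poly of_rat g"
  by (intro poly_eqI) (simp add: coeff_map_poly coeff_mult of_rat_sum of_rat_mult)

lemma ex1_min_poly:
  fixes x :: "'a :: field_char_0"
  assumes "algebraic x"
  shows "\<exists>!f. is_min_poly x f"
proof -
  define R :: "rat poly \<Rightarrow> 'a" where "R f = poly (map_poly of_rat f) x" for f
  have R_add: "R (f + g) = R f + R g" and R_mult: "R (f * g) = R f * R g" for f g
    by (simp_all add: R_def map_poly_of_rat_add map_poly_of_rat_mult)
  have R_const: "R [:c:] = of_rat c" for c
    by (simp add: R_def map_poly_monom poly_monom flip: monom_0)
  obtain q :: "'a poly" where q: "\<And>i. coeff q i \<in> \<int>" "q \<noteq> 0" "poly q x = 0"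
    using assms unfolding algebraic_def by blast
  have "\<exists>c. \<forall>i. coeff q i = of_int (c i)"
    using q(1) by (intro choice) (auto elim!: Ints_cases)
  then obtain c where c: "\<And>i. coeff q i = of_int (c i)" by blast
  define h :: "rat poly" where "h = Poly (map (\<lambda>i. of_int (c i)) [0..<Suc (degree q)])"
  have coeff_h: "of_rat (coeff h i) = coeff q i" for i
  proof (cases "i \<le> degree q")
    case True
    then show ?thesis
      by (simp add: h_def nth_default_def c del: upt_Suc)
  next
    case False
    then show ?thesis
      by (simp add: h_def nth_default_def coeff_eq_0 del: upt_Suc)
  qed
  have map_h: "map_poly of_rat h = q"
    by (intro poly_eqI) (simp add: coeff_map_poly coeff_h)
  have "h \<noteq> 0" "R h = 0"
    using map_h q(2,3) by (auto simp: R_def)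
  then obtain m0 where m0: "m0 \<noteq> 0" "R m0 = 0"
    and m0_le: "\<And>f. f \<noteq> 0 \<Longrightarrow> R f = 0 \<Longrightarrow> degree m0 \<le> degree f"
    using ex_has_least_nat[of "\<lambda>f. f \<noteq> 0 \<and> R f = 0" h degree] by auto
  define m where "m = Polynomial.smult (inverse (lead_coeff m0)) m0"
  have m: "m \<noteq> 0" "R m = 0" "lead_coeff m = 1"
    using m0 R_mult[of "[:inverse (lead_coeff m0):]" m0] by (simp_all add: m_def)
  have m_le: "degree m \<le> degree f" if "f \<noteq> 0" "R f = 0" for f
    using m0_le[OF that] m0(1) by (simp add: m_def)
  have m_dvd: "m dvd f" if "R f = 0" for f
  proof -
    have "R f = R (f div m) * R m + R (f mod m)"
      by (metis R_add R_mult div_mult_mod_eq)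
    then have "R (f mod m) = 0" using that m(2) by simp
    then have "f mod m = 0"
      using m_le[of "f mod m"] degree_mod_less[OF m(1), of f] by force
    then show ?thesis by auto
  qed
  have not_unit: "\<not> f dvd 1" if "R f = 0" for f
  proof
    assume "f dvd 1"
    then obtain g where "1 = f * g" by (elim dvdE)
    then have "R 1 = 0" using that R_mult[of f g] by (metis mult_zero_left)
    then show False using R_const[of 1] by (simp add: one_pCons)
  qed
  have irr: "irreducible m"
  proof (rule irreducibleI)
    show "m \<noteq> 0" "\<not> m dvd 1" using m not_unit by auto
    fix a b assume ab: "m = a * b"
    then have nz: "a \<noteq> 0" "b \<noteq> 0" using m(1) by auto
    have "R a = 0 \<or> R b = 0" using m(2) R_mult ab by auto
    then have "degree m \<le> degree a \<or> degree m \<le> degree b" using m_le nz by blast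
    then have "degree b = 0 \<or> degree a = 0" using ab nz by (auto simp: degree_mult_eq)
    then show "a dvd 1 \<or> b dvd 1" using nz by (auto simp: is_unit_iff_degree)
  qed
  have "is_min_poly x m"
    using m irr by (simp add: is_min_poly_def R_def)
  moreover have "f = m" if "is_min_poly x f" for f
  proof -
    from that have f: "lead_coeff f = 1" "irreducible f" "R f = 0"
      by (auto simp: is_min_poly_def R_def)
    from m_dvd[OF f(3)] obtain g where g: "f = m * g" by (elim dvdE)
    then have "g dvd 1" using f(2) not_unit[OF m(2)] irreducibleD by blast
    then obtain d where d: "g = [:d:]"
      by (metis degree_eq_zeroE is_unit_iff_degree not_is_unit_0)
    then have "d = 1" using g f(1) m(3) by (simp split: if_splits)
    then show ?thesis using g d by simp
  qed
  ultimately show ?thesis by blast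
qed

section \<open>Perron numbers and the Perron--Frobenius degree\<close>

definition perron_number :: "real \<Rightarrow> bool" where
  "perron_number p \<longleftrightarrow> algebraic_int p \<and> p \<ge> 1 \<and>
     (\<forall>z \<in> galois_conjugates p - {complex_of_real p}. cmod z < p)"

definition nonneg_mat :: "int mat \<Rightarrow> bool" where
  "nonneg_mat A \<longleftrightarrow> (\<forall>i < dim_row A. \<forall>j < dim_col A. A $$ (i, j) \<ge> 0)"

text \<open>The exponent must be positive: the zeroth power of the one-by-one zero matrix
  is already entrywise positive.\<close>

definition aperiodic_mat :: "int mat \<Rightarrow> bool" where
  "aperiodic_mat A \<longleftrightarrow> square_mat A \<and> nonneg_mat A \<and>
     (\<exists>k > 0. \<forall>i < dim_row A. \<forall>j < dim_col A. (A ^\<^sub>m k) $$ (i, j) > 0)"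

text \<open>The spectral radius of the empty matrix is an unspecified number, so matrices
  have positive dimension. By Lind's theorem the minimum is over a nonempty set
  whenever p is a Perron number; a claim about its value includes that a matrix exists.\<close>

definition perron_frobenius_degree :: "real \<Rightarrow> nat" where
  "perron_frobenius_degree p =
     (LEAST n. n > 0 \<and> (\<exists>A \<in> carrier_mat n n. aperiodic_mat A \<and>
        spectral_radius (map_mat complex_of_int A) = p))"

end

theory Submission
  imports Defs "HOL-Computational_Algebra.Field_as_Ring"
begin

text \<open>If an aperiodic \<open>n \<times> n\<close> matrix has spectral radius \<open>p\<close>, then every Galois conjugate \<open>z\<close> of \<open>p\<close> is one
  of its eigenvalues, and \<open>\<mu> = z / p\<close> is an eigenvalue of a stochastic \<open>n \<times> n\<close> matrix. When \<open>|\<mu>|\<close> is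
  close to 1, such a \<open>\<mu>\<close> must be close to a root of unity of order at most \<open>n\<close>
  (\<open>stochastic_eigenvalue_near_root_of_unity\<close>). So a Perron number has Perron--Frobenius degree above
  \<open>N\<close> as soon as some conjugate ratio lies close enough to a primitive \<open>M\<close>-th root of unity with
  \<open>M > N\<close>. What remains is to find cubic Perron numbers of this kind.

  Let \<open>\<omega> = r exp (2 \<pi> i / M)\<close> with \<open>r < 1\<close> near 1. The cubic with roots \<open>1, \<omega>, cnj \<omega>\<close>, with its roots
  multiplied by a large integer \<open>t\<close>, is approximated by irreducible integer cubics \<open>f\<close>; their real
  root \<open>p\<close> is about \<open>t\<close>, and its conjugate ratios tend to \<open>\<omega>\<close> and \<open>cnj \<omega>\<close> as \<open>t\<close> grows
  (\<open>cubic_roots_converge\<close>).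

  The degree is a minimum over matrices, so one must also exhibit a matrix for \<open>p\<close>; otherwise the
  minimum says nothing. The limit cubic divides \<open>(y - 1)(y\<^sup>M - r\<^sup>M) / (y - r)\<close>, whose coefficients below
  the leading one are all strictly negative. This survives a small perturbation of both factors, so
  \<open>f\<close> has a monic integer multiple \<open>x\<^sup>M - \<Sum> d\<^sub>j x\<^sup>M\<^sup>-\<^sup>1\<^sup>-\<^sup>j\<close> with all \<open>d\<^sub>j > 0\<close> (\<open>rounded_cubics\<close>), and
  its companion matrix is aperiodic with spectral radius \<open>p\<close>.\<close>

section \<open>Eigenvalues of stochastic matrices near the unit circle\<close>

text \<open>An averaging argument. Normalise the eigenvector so that its largest entry has modulus 1.
  Each \<open>\<mu> y\<^sub>i\<close> is a weighted mean of the entries, so some entry \<open>y\<^sub>j\<close> reaches at least as far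
  as \<open>\<mu> y\<^sub>i\<close> in its direction. Since \<open>y\<^sub>j\<close> stays in the unit disc, it must lie close to \<open>\<mu> y\<^sub>i\<close>
  when \<open>|\<mu>|\<close> is close to 1. Following \<open>i \<mapsto> j\<close> from a largest entry, some index recurs within
  \<open>n\<close> steps, and a return after \<open>m\<close> steps means that \<open>\<mu>\<^sup>m\<close> is close to 1. For \<open>|\<mu>| = 1\<close> the
  bound is the classical fact that peripheral eigenvalues are roots of unity of order at most \<open>n\<close>.\<close>
lemma stochastic_eigenvalue_near_root_of_unity:
  fixes P :: "nat \<Rightarrow> nat \<Rightarrow> real" and y :: "nat \<Rightarrow> complex"
  assumes nonneg: "\<And>i j. i < n \<Longrightarrow> j < n \<Longrightarrow> P i j \<ge> 0"
    and rowsum: "\<And>i. i < n \<Longrightarrow> (\<Sum>j<n. P i j) = 1"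
    and eig: "\<And>i. i < n \<Longrightarrow> (\<Sum>j<n. of_real (P i j) * y j) = \<mu> * y i"
    and nz: "\<exists>i<n. y i \<noteq> 0"
  shows "\<exists>m\<in>{1..n}. cmod (1 - \<mu> ^ m) * cmod \<mu> ^ n \<le> n * sqrt (1 - cmod \<mu> ^ (2 * n))"
proof -
  define K where "K = Max ((\<lambda>i. cmod (y i)) ` {..<n})"
  have n0: "{..<n} \<noteq> {}" using nz by auto
  have y_le: "cmod (y i) \<le> K" if "i < n" for i
    unfolding K_def using that by (intro Max_ge) auto
  have "K > 0" using nz y_le by (metis less_le_trans zero_less_norm_iff)
  have "K \<in> (\<lambda>i. cmod (y i)) ` {..<n}" unfolding K_def using n0 by (intro Max_in) auto
  then obtain i0 where i0: "i0 < n" "cmod (y i0) = K" by auto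
  define z where "z i = y i / of_real K" for i
  have z_le: "cmod (z i) \<le> 1" if "i < n" for i
    using y_le[OF that] \<open>K > 0\<close> by (simp add: z_def norm_divide)
  have z_i0: "cmod (z i0) = 1" using i0 \<open>K > 0\<close> by (simp add: z_def norm_divide)
  have eigz: "(\<Sum>j<n. of_real (P i j) * z j) = \<mu> * z i" if "i < n" for i
    using eig[OF that] by (simp add: z_def flip: sum_divide_distrib)
  have ex_next: "\<exists>j<n. (cmod (\<mu> * z i))\<^sup>2 \<le> Re (cnj (\<mu> * z i) * z j)" if i: "i < n" for i
  proof (rule ccontr)
    assume "\<not> ?thesis"
    then have less: "Re (cnj (\<mu> * z i) * z j) < (cmod (\<mu> * z i))\<^sup>2" if "j < n" for j
      using that by (meson not_le)
    have "(\<Sum>j<n. P i j * Re (cnj (\<mu> * z i) * z j)) = Re (cnj (\<mu> * z i) * (\<Sum>j<n. of_real (P i j) * z j))"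
      by (simp add: sum_distrib_left mult.left_commute[of "cnj _"] flip: Re_complex_of_real)
        (simp add: algebra_simps sum.distrib sum_subtractf)
    also have "\<dots> = (cmod (\<mu> * z i))\<^sup>2"
      unfolding eigz[OF i] by (metis Re_complex_of_real complex_norm_square mult.commute)
    also have "\<dots> = (\<Sum>j<n. P i j * (cmod (\<mu> * z i))\<^sup>2)"
      using rowsum[OF i] by (simp flip: sum_distrib_right)
    finally have "(\<Sum>j<n. P i j * ((cmod (\<mu> * z i))\<^sup>2 - Re (cnj (\<mu> * z i) * z j))) = 0"
      by (simp add: right_diff_distrib sum_subtractf)
    moreover have "P i j * ((cmod (\<mu> * z i))\<^sup>2 - Re (cnj (\<mu> * z i) * z j)) \<ge> 0" if "j < n" for j
      using nonneg[OF i that] less[OF that] by (intro mult_nonneg_nonneg) linarith+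
    ultimately have "P i j * ((cmod (\<mu> * z i))\<^sup>2 - Re (cnj (\<mu> * z i) * z j)) = 0" if "j < n" for j
      using that by (subst (asm) sum_nonneg_eq_0_iff) auto
    then have "P i j = 0" if "j < n" for j
      using less[OF that] that by fastforce
    then show False using rowsum[OF i] by simp
  qed
  obtain f where f: "f i < n" "(cmod (\<mu> * z i))\<^sup>2 \<le> Re (cnj (\<mu> * z i) * z (f i))" if "i < n" for i
    using ex_next by metis
  \<comment> \<open>By the cosine rule, an entry that reaches far in the direction of \<open>\<mu> z\<^sub>i\<close> is near \<open>\<mu> z\<^sub>i\<close>.\<close>
  have dist_f: "(cmod (z (f i) - \<mu> * z i))\<^sup>2 \<le> (cmod (z (f i)))\<^sup>2 - (cmod (\<mu> * z i))\<^sup>2" if "i < n" for i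
  proof -
    have "(cmod (a - w))\<^sup>2 = (cmod a)\<^sup>2 - 2 * Re (cnj w * a) + (cmod w)\<^sup>2" for a w
      unfolding cmod_power2 by (simp add: power2_eq_square algebra_simps)
    from this[of "z (f i)" "\<mu> * z i"] f(2)[OF that] show ?thesis by linarith
  qed
  have norm_f: "cmod (\<mu> * z i) \<le> cmod (z (f i))" if "i < n" for i
    using dist_f[OF that] by (smt (verit) norm_ge_zero power2_le_imp_le zero_le_power2)
  define s where "s k = (f ^^ k) i0" for k
  have s_Suc: "s (Suc k) = f (s k)" for k by (simp add: s_def)
  have s_less: "s k < n" for k by (induction k) (simp_all add: s_def i0 f)
  have s_norm: "cmod \<mu> ^ k \<le> cmod (z (s k))" for k
  proof (induction k)
    case (Suc k)
    then have "cmod \<mu> * cmod \<mu> ^ k \<le> cmod (\<mu> * z (s k))"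
      by (simp add: norm_mult mult_left_mono)
    then show ?case using norm_f[OF s_less[of k]] by (simp add: s_Suc)
  qed (simp add: s_def z_i0)
  have mu_le: "cmod \<mu> \<le> 1"
    using s_norm[of 1] z_le[OF s_less[of 1]] by simp
  define \<delta> where "\<delta> = sqrt (1 - cmod \<mu> ^ (2 * n))"
  have "\<delta> \<ge> 0" using mu_le by (simp add: \<delta>_def power_le_one)
  have step: "cmod (z (s (Suc k)) - \<mu> * z (s k)) \<le> \<delta>" if "k < n" for k
  proof -
    have "cmod \<mu> ^ n \<le> cmod \<mu> ^ Suc k"
      using mu_le that by (intro power_decreasing) auto
    also have "\<dots> \<le> cmod (\<mu> * z (s k))"
      using s_norm[of k] by (simp add: norm_mult mult_left_mono)
    finally have "(cmod \<mu> ^ n)\<^sup>2 \<le> (cmod (\<mu> * z (s k)))\<^sup>2" by (intro power_mono) auto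
    moreover have "(cmod (z (f (s k))))\<^sup>2 \<le> 1"
      using z_le[OF s_less[of "Suc k"]] by (simp add: s_Suc power_le_one)
    ultimately have "(cmod (z (s (Suc k)) - \<mu> * z (s k)))\<^sup>2 \<le> 1 - cmod \<mu> ^ (2 * n)"
      using dist_f[OF s_less[of k]] by (simp add: s_Suc power_mult power_mult_distrib mult.commute flip: power_mult)
    then show ?thesis unfolding \<delta>_def by (rule real_le_rsqrt)
  qed
  \<comment> \<open>The errors of single steps add up, since multiplication by \<open>\<mu>\<close> does not enlarge them.\<close>
  have steps: "cmod (z (s (a + m)) - \<mu> ^ m * z (s a)) \<le> m * \<delta>" if "a + m \<le> n" for a m
    using that
  proof (induction m)
    case (Suc m)
    have "z (s (a + Suc m)) - \<mu> ^ Suc m * z (s a) =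
        (z (s (Suc (a + m))) - \<mu> * z (s (a + m))) + \<mu> * (z (s (a + m)) - \<mu> ^ m * z (s a))"
      by (simp add: algebra_simps)
    also have "cmod \<dots> \<le> \<delta> + cmod \<mu> * (m * \<delta>)"
      using Suc step[of "a + m"]
      by (intro norm_triangle_mono) (auto simp: norm_mult intro!: mult_left_mono)
    also have "\<dots> \<le> \<delta> + 1 * (m * \<delta>)"
      using mu_le \<open>\<delta> \<ge> 0\<close> by (intro add_left_mono mult_right_mono) auto
    finally show ?case by (simp add: algebra_simps)
  qed simp
  \<comment> \<open>The \<open>n + 1\<close> indices visited in \<open>n\<close> steps cannot be distinct.\<close>
  have "\<not> inj_on s {..n}"
  proof
    assume "inj_on s {..n}"
    then have "card {..n} \<le> card {..<n}"
      by (rule card_inj_on_le) (use s_less in auto)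
    then show False by simp
  qed
  then obtain a b where ab: "a < b" "b \<le> n" "s a = s b"
    unfolding inj_on_def by (metis atMost_iff linorder_neqE_nat)
  define m where "m = b - a"
  have m: "m \<ge> 1" "m \<le> n" "a + m = b" using ab by (auto simp: m_def)
  have "cmod (1 - \<mu> ^ m) * cmod \<mu> ^ n \<le> cmod (1 - \<mu> ^ m) * cmod (z (s a))"
    using s_norm[of a] power_decreasing[of a n "cmod \<mu>"] mu_le ab
    by (intro mult_left_mono) auto
  also have "\<dots> = cmod (z (s (a + m)) - \<mu> ^ m * z (s a))"
    using m ab by (simp add: algebra_simps flip: norm_mult)
  also have "\<dots> \<le> m * \<delta>" using steps[of a m] m ab by simp
  also have "\<dots> \<le> n * \<delta>" using m \<open>\<delta> \<ge> 0\<close> by (intro mult_right_mono) auto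
  finally show ?thesis using m by (auto simp: \<delta>_def)
qed

section \<open>Integer matrices acting on vectors\<close>

text \<open>The action of an integer matrix on vectors over any commutative ring. Vectors are functions,
  so that one matrix acts alike on complex eigenvectors and on the real vectors of their moduli;
  only the values at indices below the dimension matter.\<close>
definition mat_app :: "int mat \<Rightarrow> (nat \<Rightarrow> 'a :: comm_ring_1) \<Rightarrow> nat \<Rightarrow> 'a" where
  "mat_app A x i = (\<Sum>j<dim_col A. of_int (A $$ (i, j)) * x j)"

lemma mat_app_cong:
  assumes "\<And>j. j < dim_col A \<Longrightarrow> x j = y j"
  shows "mat_app A x i = mat_app A y i"
  unfolding mat_app_def using assms by (intro sum.cong) auto

lemma mat_app_mult:
  assumes "A \<in> carrier_mat n n" "B \<in> carrier_mat n n" "i < n"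
  shows "mat_app (A * B) x i = mat_app A (mat_app B x) i"
proof -
  have "mat_app (A * B) x i = (\<Sum>j<n. \<Sum>l<n. of_int (A $$ (i, l)) * of_int (B $$ (l, j)) * x j)"
    using assms by (simp add: mat_app_def scalar_prod_def sum_distrib_right lessThan_atLeast0)
  also have "\<dots> = mat_app A (mat_app B x) i"
    using assms by (subst sum.swap) (simp add: mat_app_def sum_distrib_left mult.assoc)
  finally show ?thesis .
qed

lemma mat_app_pow_commute:
  assumes A: "A \<in> carrier_mat n n" and "i < n"
  shows "mat_app (A ^\<^sub>m k) (mat_app A x) i = mat_app A (mat_app (A ^\<^sub>m k) x) i"
  using \<open>i < n\<close>
proof (induction k arbitrary: i x)
  case 0
  have one: "mat_app (1\<^sub>m n) z j = z j" if "j < n" for z :: "nat \<Rightarrow> 'a" and j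
    using that by (simp add: mat_app_def if_distrib[of of_int] if_distrib[of "\<lambda>t. t * _"] cong: if_cong)
  from 0 A show ?case
    by (simp add: one) (rule mat_app_cong, simp add: one)
next
  case (Suc k)
  have "mat_app (A ^\<^sub>m Suc k) (mat_app A x) i = mat_app A (mat_app (A ^\<^sub>m k) (mat_app A x)) i"
    using A Suc by (simp add: mat_app_mult[where n = n])
  also have "\<dots> = mat_app A (mat_app (A ^\<^sub>m Suc k) x) i"
    using A by (intro mat_app_cong) (simp add: mat_app_mult[where n = n])
  finally show ?case .
qed

lemma eigenvalue_iff_mat_app:
  fixes A :: "int mat" and \<kappa> :: complex
  assumes A: "A \<in> carrier_mat n n"
  shows "eigenvalue (map_mat of_int A) \<kappa> \<longleftrightarrow>
    (\<exists>x. (\<exists>i<n. x i \<noteq> 0) \<and> (\<forall>i<n. mat_app A x i = \<kappa> * x i))"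
proof
  assume "eigenvalue (map_mat of_int A) \<kappa>"
  then obtain v where v: "v \<in> carrier_vec n" "v \<noteq> 0\<^sub>v n" "map_mat of_int A *\<^sub>v v = \<kappa> \<cdot>\<^sub>v v"
    using A by (auto simp: eigenvalue_def eigenvector_def)
  have "\<exists>i<n. v $ i \<noteq> 0" using v(1,2) by (metis carrier_vecD eq_vecI index_zero_vec)
  moreover have "mat_app A (\<lambda>i. v $ i) i = \<kappa> * v $ i" if "i < n" for i
  proof -
    have "(map_mat of_int A *\<^sub>v v) $ i = \<kappa> * v $ i" using v that by simp
    then show ?thesis
      using A v(1) that by (simp add: mat_app_def scalar_prod_def lessThan_atLeast0)
  qed
  ultimately show "\<exists>x. (\<exists>i<n. x i \<noteq> 0) \<and> (\<forall>i<n. mat_app A x i = \<kappa> * x i)" by blast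
next
  assume "\<exists>x. (\<exists>i<n. x i \<noteq> 0) \<and> (\<forall>i<n. mat_app A x i = \<kappa> * x i)"
  then obtain x where x: "\<exists>i<n. x i \<noteq> 0" "\<And>i. i < n \<Longrightarrow> mat_app A x i = \<kappa> * x i" by blast
  have "map_mat of_int A *\<^sub>v vec n x = \<kappa> \<cdot>\<^sub>v vec n x"
    using A x(2) by (intro eq_vecI) (auto simp: mat_app_def scalar_prod_def lessThan_atLeast0)
  moreover have "vec n x \<noteq> 0\<^sub>v n" using x(1) by (metis index_vec index_zero_vec(1))
  ultimately show "eigenvalue (map_mat of_int A) \<kappa>"
    using A by (auto simp: eigenvalue_def eigenvector_def intro!: exI[of _ "vec n x"])
qed

section \<open>Perron--Frobenius theory of aperiodic matrices\<close>

lemma spectral_radius_attained: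
  assumes A: "A \<in> carrier_mat n n" and "n > 0"
  shows "\<exists>\<kappa>. eigenvalue A \<kappa> \<and> cmod \<kappa> = spectral_radius A"
  using spectral_radius_mem_max(1)[OF A \<open>n > 0\<close>] by (auto simp: spectrum_def)

lemma norm_eigenvalue_le_spectral_radius:
  assumes A: "A \<in> carrier_mat n n" and "n > 0" and "eigenvalue A \<kappa>"
  shows "cmod \<kappa> \<le> spectral_radius A"
  using spectral_radius_mem_max(2)[OF A \<open>n > 0\<close>] assms(3) by (auto simp: spectrum_def)

lemma pow_smult_mat:
  fixes A :: "'a :: comm_ring_1 mat"
  assumes A: "A \<in> carrier_mat n n"
  shows "(c \<cdot>\<^sub>m A) ^\<^sub>m k = c ^ k \<cdot>\<^sub>m (A ^\<^sub>m k)"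
proof (induction k)
  case (Suc k)
  have "(c \<cdot>\<^sub>m A) ^\<^sub>m Suc k = (c ^ k \<cdot>\<^sub>m (A ^\<^sub>m k)) * (c \<cdot>\<^sub>m A)" using Suc by simp
  also have "\<dots> = c ^ Suc k \<cdot>\<^sub>m (A ^\<^sub>m Suc k)"
    using A by (intro eq_matI) (auto simp: scalar_prod_def sum_distrib_left mult_ac)
  finally show ?case .
qed (use A in auto)

text \<open>The matrix \<open>A / s\<close> has spectral radius below 1, so its powers are bounded.\<close>
lemma power_entries_bound:
  fixes A :: "complex mat"
  assumes A: "A \<in> carrier_mat n n" and "n > 0" and s: "spectral_radius A < s"
  shows "\<exists>c. \<forall>k. \<forall>i<n. \<forall>j<n. cmod ((A ^\<^sub>m k) $$ (i, j)) \<le> c * s ^ k"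
proof -
  have "s > 0"
    using spectral_radius_attained[OF A \<open>n > 0\<close>] s by (metis norm_ge_zero order_le_less_trans)
  define B where "B = (1 / complex_of_real s) \<cdot>\<^sub>m A"
  have B: "B \<in> carrier_mat n n" using A by (simp add: B_def)
  have A_eq: "A = of_real s \<cdot>\<^sub>m B"
    using A \<open>s > 0\<close> by (intro eq_matI) (auto simp: B_def)
  obtain \<kappa> where \<kappa>: "eigenvalue B \<kappa>" "cmod \<kappa> = spectral_radius B"
    using spectral_radius_attained[OF B \<open>n > 0\<close>] by blast
  then obtain v where v: "v \<in> carrier_vec n" "v \<noteq> 0\<^sub>v n" "B *\<^sub>v v = \<kappa> \<cdot>\<^sub>v v"
    using B by (auto simp: eigenvalue_def eigenvector_def)
  have "A *\<^sub>v v = (of_real s * \<kappa>) \<cdot>\<^sub>v v"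
  proof (rule eq_vecI)
    fix i assume "i < dim_vec ((of_real s * \<kappa>) \<cdot>\<^sub>v v)"
    then have i: "i < n" using v(1) by simp
    have "(A *\<^sub>v v) $ i = of_real s * (B *\<^sub>v v) $ i"
      unfolding A_eq using i v(1) B by (simp add: scalar_prod_def sum_distrib_left mult.assoc)
    then show "(A *\<^sub>v v) $ i = ((of_real s * \<kappa>) \<cdot>\<^sub>v v) $ i"
      unfolding v(3) using i v(1) by simp
  qed (use A v(1) in simp)
  then have "eigenvalue A (of_real s * \<kappa>)"
    using v A by (auto simp: eigenvalue_def eigenvector_def)
  from norm_eigenvalue_le_spectral_radius[OF A \<open>n > 0\<close> this]
  have "s * cmod \<kappa> \<le> spectral_radius A" using \<open>s > 0\<close> by (simp add: norm_mult)
  then have "s * cmod \<kappa> < s * 1" using s by linarith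
  then have "spectral_radius B < 1" using \<open>s > 0\<close> \<kappa>(2) by (metis mult_less_cancel_left_pos)
  then obtain c where c: "norm_bound (B ^\<^sub>m k) c" for k
    using spectral_radius_jnf_norm_bound_less_1[OF B _ jordan_nf_exists[OF B]]
      char_poly_factorized[OF B] by metis
  have "cmod ((A ^\<^sub>m k) $$ (i, j)) \<le> c * s ^ k" if "i < n" "j < n" for k i j
  proof -
    have "cmod ((B ^\<^sub>m k) $$ (i, j)) \<le> c"
      using c[of k] B that by (auto simp: norm_bound_def)
    then have "cmod ((B ^\<^sub>m k) $$ (i, j)) * s ^ k \<le> c * s ^ k"
      using \<open>s > 0\<close> by (intro mult_right_mono) auto
    then show ?thesis
      unfolding A_eq pow_smult_mat[OF B] using B that \<open>s > 0\<close>
      by (simp add: norm_mult norm_power mult.commute)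
  qed
  then show ?thesis by blast
qed

lemma nonneg_mat_app_le:
  fixes x y :: "nat \<Rightarrow> real"
  assumes A: "A \<in> carrier_mat n n" "nonneg_mat A" and "i < n" and le: "\<And>j. j < n \<Longrightarrow> x j \<le> y j"
  shows "mat_app A x i \<le> mat_app A y i"
  using assms unfolding mat_app_def nonneg_mat_def by (auto intro!: sum_mono mult_left_mono)

lemma nonneg_mat_mult:
  assumes "A \<in> carrier_mat n n" "B \<in> carrier_mat n n" "nonneg_mat A" "nonneg_mat B"
  shows "nonneg_mat (A * B)"
  using assms by (auto simp: nonneg_mat_def scalar_prod_def intro!: sum_nonneg)

lemma nonneg_mat_pow:
  assumes "A \<in> carrier_mat n n" "nonneg_mat A"
  shows "nonneg_mat (A ^\<^sub>m k)"
  using assms by (induction k) (auto intro!: nonneg_mat_mult[of _ n] simp: nonneg_mat_def[of "1\<^sub>m _"])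

text \<open>The easy half of the Collatz--Wielandt formula: \<open>A\<^sup>k w\<close> grows at least like \<open>q\<^sup>k w\<close>, whereas
  the entries of \<open>A\<^sup>k\<close> are \<open>O(s\<^sup>k)\<close> for every \<open>s\<close> above the spectral radius.\<close>
lemma supereigenvector_le_spectral_radius:
  assumes A: "A \<in> carrier_mat n n" "nonneg_mat A"
    and w: "\<And>i. i < n \<Longrightarrow> w i > (0 :: real)"
    and q: "\<And>i. i < n \<Longrightarrow> q * w i \<le> mat_app A w i"
    and "n > 0"
  shows "q \<le> spectral_radius (map_mat complex_of_int A)" (is "_ \<le> ?\<rho>")
proof (rule ccontr)
  assume "\<not> ?thesis"
  then have "?\<rho> < q" by simp
  then obtain s where s: "?\<rho> < s" "s < q" using dense by blast
  have "0 \<le> ?\<rho>"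
    using spectral_radius_attained[of "map_mat complex_of_int A" n] A(1) \<open>n > 0\<close>
    by (metis map_carrier_mat norm_ge_zero)
  then have pos: "s > 0" "q > 0" using s by auto
  obtain c where c: "\<And>k i j. i < n \<Longrightarrow> j < n \<Longrightarrow> cmod ((map_mat complex_of_int A ^\<^sub>m k) $$ (i, j)) \<le> c * s ^ k"
    using power_entries_bound[of "map_mat complex_of_int A" n s] A(1) \<open>n > 0\<close> s(1) by auto
  have c': "real_of_int ((A ^\<^sub>m k) $$ (i, j)) \<le> c * s ^ k" if "i < n" "j < n" for k i j
  proof -
    have "map_mat complex_of_int A ^\<^sub>m k = map_mat of_int (A ^\<^sub>m k)"
      using of_int_hom.mat_hom_pow[OF A(1)] by metis
    then show ?thesis using c[OF that, of k] A(1) that by simp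
  qed
  have low: "q ^ k * w i \<le> mat_app (A ^\<^sub>m k) w i" if "i < n" for k i
    using that
  proof (induction k arbitrary: i)
    case 0
    then show ?case using A by (simp add: mat_app_def if_distrib[of of_int] if_distrib[of "\<lambda>t. t * _"] cong: if_cong)
  next
    case (Suc k)
    have "q ^ Suc k * w i \<le> q * mat_app (A ^\<^sub>m k) w i"
      using Suc pos by simp
    also have "\<dots> = mat_app (A ^\<^sub>m k) (\<lambda>j. q * w j) i"
      by (simp add: mat_app_def sum_distrib_left mult.left_commute)
    also have "\<dots> \<le> mat_app (A ^\<^sub>m k) (mat_app A w) i"
      using A Suc.prems q by (intro nonneg_mat_app_le[where n = n] nonneg_mat_pow) auto
    also have "\<dots> = mat_app (A ^\<^sub>m Suc k) w i"
      using A Suc.prems by (simp add: mat_app_mult[where n = n])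
    finally show ?case .
  qed
  define C where "C = c * sum w {..<n}"
  have "(q / s) ^ k * w 0 \<le> C" for k
  proof -
    have "q ^ k * w 0 \<le> (\<Sum>j<n. real_of_int ((A ^\<^sub>m k) $$ (0, j)) * w j)"
      using low[OF \<open>n > 0\<close>, of k]
      unfolding mat_app_def carrier_matD(2)[OF pow_carrier_mat[OF A(1)]] .
    also have "\<dots> \<le> (\<Sum>j<n. (c * s ^ k) * w j)"
      using c' w \<open>n > 0\<close> by (intro sum_mono mult_right_mono) (auto intro: less_imp_le)
    also have "\<dots> = C * s ^ k" by (simp add: C_def sum_distrib_left sum_distrib_right algebra_simps)
    finally show ?thesis using pos by (simp add: power_divide field_simps)
  qed
  moreover obtain k where "C / w 0 < (q / s) ^ k"
    using real_arch_pow[of "q / s"] s pos by auto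
  ultimately show False
    using w[OF \<open>n > 0\<close>] by (meson divide_less_eq not_le)
qed

text \<open>Wielandt's argument. Let \<open>y\<close> be the vector of moduli of an eigenvector for an eigenvalue of
  largest modulus \<open>\<rho>\<close>, so that \<open>A y \<ge> \<rho> y\<close>. Were this not an equality, an entrywise positive power
  \<open>B\<close> of \<open>A\<close> would make the defect positive everywhere: \<open>A (B y) \<ge> (\<rho> + \<epsilon>) B y\<close> with \<open>B y > 0\<close>, which the
  growth of powers forbids. So \<open>B y\<close> is a positive eigenvector for \<open>\<rho>\<close>. In particular the spectral
  radius is itself an eigenvalue.\<close>
theorem perron_eigenvector:
  assumes A: "A \<in> carrier_mat n n" "aperiodic_mat A" and "n > 0"
  shows "\<exists>v :: nat \<Rightarrow> real. (\<forall>i<n. v i > 0) \<and>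
    (\<forall>i<n. mat_app A v i = spectral_radius (map_mat complex_of_int A) * v i)"
proof -
  define \<rho> where "\<rho> = spectral_radius (map_mat complex_of_int A)"
  have nn: "nonneg_mat A" using A(2) by (simp add: aperiodic_mat_def)
  obtain k where k: "\<And>i j. i < n \<Longrightarrow> j < n \<Longrightarrow> (A ^\<^sub>m k) $$ (i, j) > 0"
    using A by (auto simp: aperiodic_mat_def)
  let ?B = "A ^\<^sub>m k"
  have B: "?B \<in> carrier_mat n n" using A by simp
  have B_pos: "mat_app ?B u i > 0" if "i < n" "j < n" "u j > 0" "\<And>j. j < n \<Longrightarrow> u j \<ge> (0 :: real)" for u i j
  proof -
    have "0 \<le> real_of_int (?B $$ (i, l)) * u l" if "l < n" for l
      using k[OF \<open>i < n\<close> that] \<open>\<And>j. j < n \<Longrightarrow> u j \<ge> 0\<close>[OF that] by simp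
    moreover have "0 < real_of_int (?B $$ (i, j)) * u j"
      using k[OF \<open>i < n\<close> \<open>j < n\<close>] \<open>u j > 0\<close> by simp
    ultimately have "0 < (\<Sum>l<n. real_of_int (?B $$ (i, l)) * u l)"
      using \<open>j < n\<close> by (intro sum_pos2[of _ j]) simp_all
    then show ?thesis unfolding mat_app_def carrier_matD(2)[OF B] .
  qed
  obtain \<kappa> where "eigenvalue (map_mat complex_of_int A) \<kappa>" and \<kappa>: "cmod \<kappa> = \<rho>"
    using spectral_radius_attained[of "map_mat complex_of_int A" n] A(1) \<open>n > 0\<close>
    unfolding \<rho>_def by auto
  then obtain x where x: "\<exists>i<n. x i \<noteq> 0" "\<And>i. i < n \<Longrightarrow> mat_app A x i = \<kappa> * x i"
    using eigenvalue_iff_mat_app[OF A(1)] by blast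
  define y where "y i = cmod (x i)" for i
  define z where "z i = mat_app A y i - \<rho> * y i" for i
  have z_nonneg: "z i \<ge> 0" if "i < n" for i
  proof -
    have "\<rho> * y i = cmod (mat_app A x i)" using x(2)[OF that] \<kappa> by (simp add: norm_mult y_def)
    also have "\<dots> \<le> mat_app A y i"
      using nn A(1) that unfolding mat_app_def y_def nonneg_mat_def
      by (intro sum_norm_le) (auto simp: norm_mult)
    finally show ?thesis by (simp add: z_def)
  qed
  define w where "w = mat_app ?B y"
  have w_pos: "w i > 0" if "i < n" for i
    using B_pos[OF that, of _ y] x(1) unfolding w_def by (auto simp: y_def)
  have Aw: "mat_app A w i = \<rho> * w i + mat_app ?B z i" if "i < n" for i
  proof -
    have "mat_app A w i = mat_app ?B (mat_app A y) i"
      unfolding w_def using mat_app_pow_commute[OF A(1) that] by metis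
    then show ?thesis
      by (simp add: w_def z_def[abs_def] mat_app_def[of ?B] algebra_simps sum_subtractf sum_distrib_left)
  qed
  have z0: "z i = 0" if "i < n" for i
  proof (rule ccontr)
    assume "z i \<noteq> 0"
    then have Bz: "mat_app ?B z j > 0" if "j < n" for j
      using B_pos[OF that \<open>i < n\<close>] z_nonneg \<open>i < n\<close> by (simp add: order_less_le)
    define \<epsilon> where "\<epsilon> = Min ((\<lambda>j. mat_app ?B z j / w j) ` {..<n})"
    have "\<epsilon> > 0" unfolding \<epsilon>_def using Bz w_pos \<open>n > 0\<close> by (subst Min_gr_iff) auto
    have "(\<rho> + \<epsilon>) * w j \<le> mat_app A w j" if "j < n" for j
    proof -
      have "\<epsilon> \<le> mat_app ?B z j / w j" unfolding \<epsilon>_def using that by (intro Min_le) auto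
      then show ?thesis using w_pos[OF that] Aw[OF that] by (simp add: field_simps)
    qed
    from supereigenvector_le_spectral_radius[OF A(1) nn w_pos this \<open>n > 0\<close>] \<open>\<epsilon> > 0\<close>
    show False by (simp add: \<rho>_def)
  qed
  then have "mat_app ?B z i = 0" if "i < n" for i
    unfolding mat_app_def carrier_matD(2)[OF B] by simp
  with Aw w_pos show ?thesis unfolding \<rho>_def[symmetric] by (intro exI[of _ w]) auto
qed

text \<open>A positive eigenvector identifies the spectral radius: the upper bound comes from the maximum
  norm weighted by \<open>v\<close>, in which the matrix has operator norm \<open>p\<close>.\<close>
lemma spectral_radius_eqI:
  assumes A: "A \<in> carrier_mat n n" "nonneg_mat A" and "n > 0"
    and v: "\<And>i. i < n \<Longrightarrow> v i > (0 :: real)" "\<And>i. i < n \<Longrightarrow> mat_app A v i = p * v i"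
  shows "spectral_radius (map_mat complex_of_int A) = p" (is "?\<rho> = p")
proof (rule antisym)
  show "p \<le> ?\<rho>"
    using supereigenvector_le_spectral_radius[OF A v(1) _ \<open>n > 0\<close>, where q = p] v(2) by simp
next
  obtain \<kappa> where "eigenvalue (map_mat complex_of_int A) \<kappa>" and \<kappa>: "cmod \<kappa> = ?\<rho>"
    using spectral_radius_attained[of "map_mat complex_of_int A" n] A(1) \<open>n > 0\<close> by auto
  then obtain x where x: "\<exists>i<n. x i \<noteq> 0" "\<And>i. i < n \<Longrightarrow> mat_app A x i = \<kappa> * x i"
    using eigenvalue_iff_mat_app[OF A(1)] by blast
  define K where "K = Max ((\<lambda>i. cmod (x i) / v i) ` {..<n})"
  have "cmod (x i) / v i \<le> K" if "i < n" for i
    unfolding K_def using that by (intro Max_ge) auto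
  then have K_ge: "cmod (x i) \<le> K * v i" if "i < n" for i
    using v(1) that by (simp add: pos_divide_le_eq)
  have "K \<in> (\<lambda>i. cmod (x i) / v i) ` {..<n}"
    unfolding K_def using \<open>n > 0\<close> by (intro Max_in) auto
  then obtain i where i: "i < n" "cmod (x i) = K * v i" using v(1) by fastforce
  have "K > 0"
  proof -
    obtain l where l: "l < n" "x l \<noteq> 0" using x(1) by blast
    have "0 < cmod (x l)" using l(2) by simp
    also have "\<dots> \<le> K * v l" by (rule K_ge[OF l(1)])
    finally show ?thesis using v(1)[OF l(1)] by (simp add: zero_less_mult_iff)
  qed
  have "cmod \<kappa> * (K * v i) = cmod (mat_app A x i)"
    using x(2)[OF i(1)] i(2) by (simp add: norm_mult)
  also have "\<dots> \<le> (\<Sum>j<n. of_int (A $$ (i, j)) * (K * v j))"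
    unfolding mat_app_def carrier_matD(2)[OF A(1)]
  proof (rule sum_norm_le)
    fix j assume "j \<in> {..<n}"
    then have "A $$ (i, j) \<ge> 0" "cmod (x j) \<le> K * v j"
      using A i(1) K_ge by (auto simp: nonneg_mat_def)
    then show "cmod (of_int (A $$ (i, j)) * x j) \<le> of_int (A $$ (i, j)) * (K * v j)"
      by (simp add: norm_mult mult_left_mono)
  qed
  also have "\<dots> = K * mat_app A v i"
    using A(1) by (simp add: mat_app_def sum_distrib_left mult.left_commute)
  also have "\<dots> = p * (K * v i)" using v(2)[OF i(1)] by simp
  finally show "?\<rho> \<le> p" using \<kappa> v(1)[OF i(1)] \<open>K > 0\<close> by simp
qed

text \<open>The Perron vector \<open>v\<close> rescales \<open>A\<close> to the stochastic matrix with entries \<open>a\<^sub>i\<^sub>j v\<^sub>j / (p v\<^sub>i)\<close>,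
  whose eigenvalues are those of \<open>A\<close> divided by \<open>p\<close>.\<close>
theorem eigenvalue_of_aperiodic_matrix_near_root_of_unity:
  assumes A: "A \<in> carrier_mat n n" "aperiodic_mat A" and "n > 0"
    and p: "spectral_radius (map_mat complex_of_int A) = p" "p > 0"
    and ev: "eigenvalue (map_mat complex_of_int A) z"
  defines "\<mu> \<equiv> z / of_real p"
  shows "\<exists>m\<in>{1..n}. cmod (1 - \<mu> ^ m) * cmod \<mu> ^ n \<le> n * sqrt (1 - cmod \<mu> ^ (2 * n))"
proof -
  obtain v :: "nat \<Rightarrow> real" where v: "\<And>i. i < n \<Longrightarrow> v i > 0" "\<And>i. i < n \<Longrightarrow> mat_app A v i = p * v i"
    using perron_eigenvector[OF A \<open>n > 0\<close>] p(1) by auto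
  obtain x where x: "\<exists>i<n. x i \<noteq> 0" "\<And>i. i < n \<Longrightarrow> mat_app A x i = z * x i"
    using ev eigenvalue_iff_mat_app[OF A(1)] by blast
  define P where "P i j = of_int (A $$ (i, j)) * v j / (p * v i)" for i j
  have nonneg: "P i j \<ge> 0" if "i < n" "j < n" for i j
    using A v(1)[OF that(1)] v(1)[OF that(2)] p(2) that
    by (simp add: P_def aperiodic_mat_def nonneg_mat_def)
  have rowsum: "(\<Sum>j<n. P i j) = 1" if "i < n" for i
  proof -
    have "(\<Sum>j<n. P i j) = mat_app A v i / (p * v i)"
      using A(1) by (simp add: P_def mat_app_def flip: sum_divide_distrib)
    then show ?thesis using v[OF that] p(2) by simp
  qed
  have eig: "(\<Sum>j<n. of_real (P i j) * (x j / of_real (v j))) = \<mu> * (x i / of_real (v i))" if "i < n" for i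
  proof -
    have "of_real (P i j) * (x j / of_real (v j)) = of_int (A $$ (i, j)) * x j / of_real (p * v i)"
      if "j < n" for j
      using v(1)[OF that] by (simp add: P_def)
    then have "(\<Sum>j<n. of_real (P i j) * (x j / of_real (v j))) = mat_app A x i / of_real (p * v i)"
      using A(1) by (simp add: mat_app_def flip: sum_divide_distrib)
    then show ?thesis using x(2)[OF that] by (simp add: \<mu>_def)
  qed
  have "\<exists>i<n. x i / of_real (v i) \<noteq> 0" using x(1) v(1) by (metis divide_eq_0_iff less_irrefl of_real_eq_0_iff)
  from stochastic_eigenvalue_near_root_of_unity[OF nonneg rowsum eig this] show ?thesis .
qed

section \<open>Companion matrices\<close>

text \<open>The companion matrix of \<open>x\<^sup>M - c\<^sub>0 x\<^sup>M\<^sup>-\<^sup>1 - \<dots> - c\<^sub>M\<^sub>-\<^sub>1\<close>, in the form whose first row holds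
  the coefficients; a root \<open>p\<close> has the eigenvector \<open>(p\<^sup>M\<^sup>-\<^sup>1, \<dots>, p, 1)\<close>.\<close>
definition companion_matrix :: "(nat \<Rightarrow> int) \<Rightarrow> nat \<Rightarrow> int mat" where
  "companion_matrix c M = mat M M (\<lambda>(i, j). if i = 0 then c j else if i = Suc j then 1 else 0)"

text \<open>From \<open>i\<close> one can walk down to 0, wait there on the loop of weight \<open>c\<^sub>0\<close>, and jump from 0 to any
  \<open>j\<close>; the waiting time makes every such walk have length exactly \<open>M\<close>.\<close>
lemma companion_matrix_aperiodic:
  assumes "M > 0" and c: "\<And>j. j < M \<Longrightarrow> c j > 0"
  shows "aperiodic_mat (companion_matrix c M)"
proof -
  let ?A = "companion_matrix c M"
  have A: "?A \<in> carrier_mat M M" by (simp add: companion_matrix_def)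
  have entry: "?A $$ (i, j) = (if i = 0 then c j else if i = Suc j then 1 else 0)" if "i < M" "j < M" for i j
    using that by (simp add: companion_matrix_def)
  have entry_nonneg: "?A $$ (i, j) \<ge> 0" if "i < M" "j < M" for i j
    using c[OF \<open>j < M\<close>] by (simp add: entry[OF that])
  then have nn: "nonneg_mat ?A"
    using A by (simp add: nonneg_mat_def)
  have nn_pow: "(?A ^\<^sub>m k) $$ (i, j) \<ge> 0" if "i < M" "j < M" for k i j
    using nonneg_mat_pow[OF A nn, of k] A that by (simp add: nonneg_mat_def)
  have pow_Suc: "(?A ^\<^sub>m Suc k) $$ (i, j) = (\<Sum>l<M. (?A ^\<^sub>m k) $$ (i, l) * ?A $$ (l, j))"
    if "i < M" "j < M" for k i j
    using A that by (simp add: scalar_prod_def lessThan_atLeast0)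
  \<comment> \<open>Two kinds of walks of length \<open>k\<close>: those that reach 0 and wait, and direct descents.\<close>
  have reach: "(?A ^\<^sub>m k) $$ (i, j) > 0" if "i < M" "j \<le> i" "i - j \<le> k" "j = 0 \<or> k = i - j" for i j k
    using that
  proof (induction k arbitrary: j)
    case 0
    then show ?case using A by simp
  next
    case (Suc k)
    have "j < M" using Suc.prems by simp
    have ?case if "l < M" "(?A ^\<^sub>m k) $$ (i, l) > 0" "?A $$ (l, j) > 0" for l
      unfolding pow_Suc[OF \<open>i < M\<close> \<open>j < M\<close>]
      using that nn_pow[OF \<open>i < M\<close>] entry_nonneg[OF _ \<open>j < M\<close>]
      by (intro sum_pos2[of _ l] mult_nonneg_nonneg mult_pos_pos) auto
    note step = this
    show ?case
    proof (cases "j = 0 \<and> i \<le> k")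
      case True
      then have "(?A ^\<^sub>m k) $$ (i, 0) > 0" by (intro Suc.IH \<open>i < M\<close>) auto
      moreover have "?A $$ (0, j) > 0" using c[OF \<open>j < M\<close>] \<open>M > 0\<close> \<open>j < M\<close> by (simp add: entry)
      ultimately show ?thesis using step \<open>M > 0\<close> by blast
    next
      case False
      then have i: "Suc j \<le> i" "Suc k = i - j" using Suc.prems by auto
      then have "(?A ^\<^sub>m k) $$ (i, Suc j) > 0" by (intro Suc.IH \<open>i < M\<close>) auto
      moreover have "Suc j < M" using i \<open>i < M\<close> by simp
      moreover from this have "?A $$ (Suc j, j) > 0" by (simp add: entry)
      ultimately show ?thesis using step by blast
    qed
  qed
  have "(?A ^\<^sub>m M) $$ (i, j) > 0" if "i < M" "j < M" for i j
  proof -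
    obtain k where M: "M = Suc k" using \<open>M > 0\<close> by (cases M) auto
    have "(?A ^\<^sub>m k) $$ (i, 0) > 0" using reach[of i 0 k] that M by simp
    then have "0 < (?A ^\<^sub>m k) $$ (i, 0) * ?A $$ (0, j)"
      using c \<open>M > 0\<close> that by (simp add: entry)
    then have "0 < (\<Sum>l<M. (?A ^\<^sub>m k) $$ (i, l) * ?A $$ (l, j))"
      using \<open>M > 0\<close> nn_pow[OF \<open>i < M\<close>] entry_nonneg[OF _ \<open>j < M\<close>]
      by (intro sum_pos2[of _ 0] mult_nonneg_nonneg) auto
    then show ?thesis using pow_Suc[OF that, of k] M by metis
  qed
  then show ?thesis using A nn \<open>M > 0\<close> unfolding aperiodic_mat_def by (auto simp: intro!: exI[of _ M])
qed

lemma companion_matrix_spectral_radius: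
  fixes p :: real
  assumes "M > 0" and c: "\<And>j. j < M \<Longrightarrow> c j > 0" and "p > 0"
    and root: "p ^ M = (\<Sum>j<M. of_int (c j) * p ^ (M - 1 - j))"
  shows "spectral_radius (map_mat complex_of_int (companion_matrix c M)) = p"
proof (rule spectral_radius_eqI)
  let ?A = "companion_matrix c M"
  show A: "?A \<in> carrier_mat M M" by (simp add: companion_matrix_def)
  show "nonneg_mat ?A"
    using companion_matrix_aperiodic[OF assms(1) c] by (simp add: aperiodic_mat_def)
  show "mat_app ?A (\<lambda>j. p ^ (M - 1 - j)) i = p * p ^ (M - 1 - i)" if "i < M" for i
  proof (cases i)
    case 0
    have "p * p ^ (M - 1) = p ^ M" using \<open>M > 0\<close> by (metis power_minus_mult mult.commute)
    then show ?thesis using root 0 that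
      by (simp add: mat_app_def companion_matrix_def)
  next
    case (Suc l)
    have "mat_app ?A (\<lambda>j. p ^ (M - 1 - j)) i = (\<Sum>j<M. if j = l then p ^ (M - 1 - j) else 0)"
      using that Suc unfolding mat_app_def companion_matrix_def by (intro sum.cong) auto
    also have "\<dots> = p ^ Suc (M - 1 - i)" using that Suc by (simp add: Suc_diff_Suc)
    finally show ?thesis by simp
  qed
qed (use assms in auto)

section \<open>Minimal polynomials and eigenvalues\<close>

lemma map_poly_of_rat_of_int:
  "map_poly (of_rat :: rat \<Rightarrow> 'a :: field_char_0) (map_poly of_int f) = map_poly of_int f"
  by (intro poly_eqI) (simp add: coeff_map_poly)

lemma is_min_poly_dvd:
  fixes x :: "'a :: field_char_0"
  assumes f: "is_min_poly x f" and g: "poly (map_poly of_rat g) x = 0"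
  shows "f dvd g"
proof (rule ccontr)
  assume "\<not> f dvd g"
  moreover have "prime_elem f"
    using f by (auto simp: is_min_poly_def intro: field_poly_irreducible_imp_prime)
  ultimately have "coprime f g" by (simp add: prime_elem_imp_coprime)
  then obtain a b where "a * f + b * g = 1"
    by (metis bezout_coefficients_fst_snd coprime_iff_gcd_eq_1)
  then have "map_poly of_rat a * map_poly of_rat f + map_poly of_rat b * map_poly of_rat g = (map_poly of_rat 1 :: 'a poly)"
    by (metis map_poly_of_rat_add map_poly_of_rat_mult)
  then have "poly (map_poly of_rat a * map_poly of_rat f + map_poly of_rat b * map_poly of_rat g) x = 1"
    by simp
  then show False using f g by (simp add: is_min_poly_def)
qed

lemma min_poly_eqI:
  assumes "is_min_poly x f"
  shows "min_poly x = f"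
  unfolding min_poly_def
  using assms
  by (intro the_equality poly_dvd_antisym) (auto intro: is_min_poly_dvd simp: is_min_poly_def)
text \<open>The characteristic polynomial has rational coefficients and vanishes at \<open>p\<close>, so the minimal
  polynomial of \<open>p\<close> divides it.\<close>
lemma conjugate_is_eigenvalue:
  fixes A :: "int mat" and p :: real
  assumes A: "A \<in> carrier_mat n n"
    and f: "is_min_poly p f" and p: "eigenvalue (map_mat complex_of_int A) (of_real p)"
    and z: "poly (map_poly of_rat f) z = 0"
  shows "eigenvalue (map_mat complex_of_int A) z"
proof -
  have char: "char_poly (map_mat complex_of_int A) = map_poly of_int (char_poly A)"
    using of_int_hom.char_poly_hom[OF A] by metis
  have ev: "eigenvalue (map_mat complex_of_int A) w \<longleftrightarrow> poly (map_poly of_int (char_poly A)) w = 0" for w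
    using eigenvalue_root_char_poly[of "map_mat complex_of_int A" n w] A char by simp
  have "complex_of_real (poly (map_poly of_int (char_poly A)) p) = poly (map_poly of_int (char_poly A)) (of_real p)"
    by (simp add: poly_altdef coeff_map_poly degree_map_poly)
  then have "poly (map_poly of_int (char_poly A)) p = 0"
    using p ev by simp
  then have "f dvd map_poly of_int (char_poly A)"
    by (intro is_min_poly_dvd[OF f]) (simp add: map_poly_of_rat_of_int)
  then obtain g where "map_poly of_int (char_poly A) = f * g" by (elim dvdE)
  then have "map_poly of_int (char_poly A) = map_poly of_rat f * (map_poly of_rat g :: complex poly)"
    by (metis map_poly_of_rat_of_int map_poly_of_rat_mult)
  then show ?thesis using z ev by simp
qed

text \<open>Eisenstein's criterion at 2. In degree 3 it suffices to exclude rational roots; these would be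
  integers, hence even, and would force \<open>c\<close> to be divisible by 4.\<close>
lemma irreducible_cubic_mod_four:
  fixes a b c :: int
  assumes "even a" "even b" "c mod 4 = 2"
  shows "irreducible [:of_int c, of_int b, of_int a, 1 :: rat:]" (is "irreducible ?f")
proof -
  have no_root: "poly ?f x \<noteq> 0" for x
  proof
    assume root: "poly ?f x = 0"
    have "algebraic_int x"
      using root by (intro algebraic_int.intros[of ?f]) (auto simp: coeff_pCons split: nat.splits)
    moreover have "x \<in> \<rat>" by (cases x) (simp add: Fract_of_int_quotient)
    ultimately have "x \<in> \<int>" by (rule rational_algebraic_int_is_int)
    then obtain k where k: "x = of_int k" by (elim Ints_cases)
    have "of_int (c + k * (b + k * (a + k))) = (0 :: rat)"
      using root by (simp add: k algebra_simps)
    then have eq: "c + k * (b + k * (a + k)) = 0" by (simp only: of_int_eq_0_iff)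
    have "even c" using assms(3) by presburger
    then have "even k"
      using eq assms(1,2) by (metis even_add even_mult_iff even_zero)
    then obtain l where l: "k = 2 * l" by (elim evenE)
    obtain b' where "b = 2 * b'" using assms(2) by (elim evenE)
    then have "c = 4 * - (l * (b' + l * (a + k)))" using eq by (simp add: l algebra_simps)
    then show False using assms(3) by (metis mod_mult_self1_is_0 zero_neq_numeral)
  qed
  have no_linear: False if "?f = g * h" "degree g = 1" for g h
  proof -
    have "\<exists>x. poly g x = 0"
    proof -
      obtain u v where g: "g = [:u, v:]" "v \<noteq> 0"
        using \<open>degree g = 1\<close> by (metis degree1_coeffs)
      then show ?thesis by (intro exI[of _ "- u / v"]) simp
    qed
    then show False using no_root that(1) by (metis mult_zero_left poly_mult)
  qed
  show ?thesis
  proof (rule irreducibleI)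
    fix g h assume gh: "?f = g * h"
    then have nz: "g \<noteq> 0" "h \<noteq> 0" by auto
    have "degree g + degree h = 3"
      using degree_mult_eq[OF nz] gh by (metis degree_pCons_eq_if degree_0 one_neq_zero pCons_eq_0_iff numeral_3_eq_3)
    moreover have "degree g \<noteq> 1" "degree h \<noteq> 1"
      using no_linear gh mult.commute by metis+
    ultimately have "degree g = 0 \<or> degree h = 0" by linarith
    then show "g dvd 1 \<or> h dvd 1" using nz by (auto simp: is_unit_iff_degree)
  qed (auto simp: is_unit_iff_degree)
qed

section \<open>Roots of converging real cubics\<close>

lemma tendsto_if_norm_diff_le:
  fixes f :: "'a \<Rightarrow> real"
  assumes e: "(e \<longlongrightarrow> 0) F" and le: "\<forall>\<^sub>F t in F. \<bar>f t - l\<bar> \<le> e t"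
  shows "(f \<longlongrightarrow> l) F"
proof -
  have "\<forall>\<^sub>F t in F. norm (f t - l) \<le> norm (e t) * 1"
    using le by eventually_elim simp
  from tendsto_0_le[OF e this] show ?thesis by (simp add: LIM_zero_iff)
qed

text \<open>The limit cubic is \<open>(y - 1)(y - \<omega>)(y - cnj \<omega>)\<close>. A real root \<open>q\<close> in \<open>[0, 2]\<close> exists by the
  intermediate value theorem and tends to 1 because the limit cubic has size at least
  \<open>|q - 1| (Im \<omega>)\<^sup>2\<close> at \<open>q\<close>; the other two roots then come from the formula for the remaining
  quadratic factor, which depends continuously on its coefficients.\<close>
lemma cubic_roots_converge:
  fixes a b c :: "nat \<Rightarrow> real" and \<omega> :: complex
  assumes a: "a \<longlonglongrightarrow> - 1 - 2 * Re \<omega>" and b: "b \<longlonglongrightarrow> 2 * Re \<omega> + (cmod \<omega>)\<^sup>2"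
    and c: "c \<longlonglongrightarrow> - (cmod \<omega>)\<^sup>2" and \<omega>: "Im \<omega> > 0"
  shows "\<exists>q z. q \<longlonglongrightarrow> 1 \<and> z \<longlonglongrightarrow> \<omega> \<and>
    (\<forall>\<^sub>F t in sequentially. \<forall>y. y ^ 3 + of_real (a t) * y\<^sup>2 + of_real (b t) * y + of_real (c t) =
      (y - of_real (q t)) * (y - z t) * (y - cnj (z t)))"
proof -
  define F where "F t y = y ^ 3 + a t * y\<^sup>2 + b t * y + c t" for t and y :: real
  define L where "L y = y ^ 3 + (- 1 - 2 * Re \<omega>) * y\<^sup>2 + (2 * Re \<omega> + (cmod \<omega>)\<^sup>2) * y - (cmod \<omega>)\<^sup>2" for y
  have L_eq: "L y = (y - 1) * ((y - Re \<omega>)\<^sup>2 + (Im \<omega>)\<^sup>2)" for y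
    unfolding L_def cmod_power2 by (simp add: power2_eq_square power3_eq_cube algebra_simps)
  have F_lim: "(\<lambda>t. F t y) \<longlonglongrightarrow> L y" for y
    unfolding F_def L_def by (auto intro!: tendsto_eq_intros a b c)
  have "(y - Re \<omega>)\<^sup>2 + (Im \<omega>)\<^sup>2 > 0" for y
    using \<omega> by (intro add_nonneg_pos) auto
  from this[of 0] this[of 2] have "L 0 < 0" "L 2 > 0" by (simp_all add: L_eq)
  then have "\<forall>\<^sub>F t in sequentially. F t 0 < 0" "\<forall>\<^sub>F t in sequentially. F t 2 > 0"
    using F_lim order_tendstoD by blast+
  then have ev_root: "\<forall>\<^sub>F t in sequentially. \<exists>y\<in>{0..2}. F t y = 0"
  proof eventually_elim
    case (elim t)
    have "continuous_on {0..2} (F t)" unfolding F_def by (intro continuous_intros)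
    then show ?case using IVT'[of "F t" 0 0 2] elim by force
  qed
  define q where "q t = (SOME y. y \<in> {0..2} \<and> F t y = 0)" for t
  have q: "\<forall>\<^sub>F t in sequentially. q t \<in> {0..2} \<and> F t (q t) = 0"
    using ev_root unfolding q_def by eventually_elim (rule someI_ex, auto)
  define da where "da t = a t - (- 1 - 2 * Re \<omega>)" for t
  define db where "db t = b t - (2 * Re \<omega> + (cmod \<omega>)\<^sup>2)" for t
  define dc where "dc t = c t - (- (cmod \<omega>)\<^sup>2)" for t
  define e where "e t = (\<bar>da t\<bar> * 4 + \<bar>db t\<bar> * 2 + \<bar>dc t\<bar>) / (Im \<omega>)\<^sup>2" for t
  have "da \<longlonglongrightarrow> 0" "db \<longlonglongrightarrow> 0" "dc \<longlonglongrightarrow> 0"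
    unfolding da_def db_def dc_def using a b c LIM_zero by blast+
  then have "e \<longlonglongrightarrow> (\<bar>0\<bar> * 4 + \<bar>0\<bar> * 2 + \<bar>0\<bar>) / (Im \<omega>)\<^sup>2"
    unfolding e_def using \<omega> by (intro tendsto_intros) auto
  then have e0: "e \<longlonglongrightarrow> 0" by simp
  have "\<forall>\<^sub>F t in sequentially. \<bar>q t - 1\<bar> \<le> e t"
    using q
  proof eventually_elim
    case (elim t)
    then have y: "0 \<le> q t" "q t \<le> 2" "F t (q t) = 0" by auto
    have "\<bar>q t - 1\<bar> * (Im \<omega>)\<^sup>2 \<le> \<bar>q t - 1\<bar> * ((q t - Re \<omega>)\<^sup>2 + (Im \<omega>)\<^sup>2)"
      by (intro mult_left_mono) auto
    also have "\<dots> = \<bar>L (q t)\<bar>" unfolding L_eq abs_mult by simp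
    also have "L (q t) = F t (q t) - (da t * (q t)\<^sup>2 + db t * q t + dc t)"
      by (simp add: L_def F_def da_def db_def dc_def algebra_simps)
    also have "\<bar>\<dots>\<bar> \<le> \<bar>da t * (q t)\<^sup>2\<bar> + \<bar>db t * q t\<bar> + \<bar>dc t\<bar>"
      unfolding y(3) by linarith
    also have "\<dots> = \<bar>da t\<bar> * (q t)\<^sup>2 + \<bar>db t\<bar> * q t + \<bar>dc t\<bar>"
      using y(1) by (simp add: abs_mult)
    also have "\<dots> \<le> \<bar>da t\<bar> * 4 + \<bar>db t\<bar> * 2 + \<bar>dc t\<bar>"
      using y(1,2) power_mono[of "q t" 2 2] by (intro add_mono mult_left_mono) auto
    finally show ?case using \<omega> by (simp add: e_def pos_le_divide_eq)
  qed
  then have q_lim: "q \<longlonglongrightarrow> 1" by (rule tendsto_if_norm_diff_le[OF e0])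
  define u where "u t = a t + q t" for t
  define w where "w t = b t + q t * u t" for t
  have "u \<longlonglongrightarrow> (- 1 - 2 * Re \<omega>) + 1" unfolding u_def by (intro tendsto_intros a q_lim)
  then have u_lim: "u \<longlonglongrightarrow> - 2 * Re \<omega>" by simp
  have "w \<longlonglongrightarrow> (2 * Re \<omega> + (cmod \<omega>)\<^sup>2) + 1 * (- 2 * Re \<omega>)"
    unfolding w_def by (intro tendsto_intros b q_lim u_lim)
  then have w_lim: "w \<longlonglongrightarrow> (cmod \<omega>)\<^sup>2" by simp
  define D where "D t = w t - (u t)\<^sup>2 / 4" for t
  have "D \<longlonglongrightarrow> (cmod \<omega>)\<^sup>2 - (- 2 * Re \<omega>)\<^sup>2 / 4"
    unfolding D_def by (intro tendsto_intros u_lim w_lim) auto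
  then have D_lim: "D \<longlonglongrightarrow> (Im \<omega>)\<^sup>2" by (simp add: cmod_power2 power_mult_distrib)
  \<comment> \<open>The quadratic factor is \<open>y\<^sup>2 + u y + w\<close>, with discriminant \<open>-4 D\<close>.\<close>
  define z where "z t = Complex (- (u t / 2)) (sqrt (D t))" for t
  have "z \<longlonglongrightarrow> Complex (- ((- 2 * Re \<omega>) / 2)) (sqrt ((Im \<omega>)\<^sup>2))"
    unfolding z_def by (intro tendsto_intros u_lim D_lim) auto
  then have z_lim: "z \<longlonglongrightarrow> \<omega>" using \<omega> by (simp add: complex_eq_iff)
  have "\<forall>\<^sub>F t in sequentially. D t > 0"
    using order_tendstoD(1)[OF D_lim, of 0] \<omega> by simp
  then have "\<forall>\<^sub>F t in sequentially. \<forall>y. y ^ 3 + of_real (a t) * y\<^sup>2 + of_real (b t) * y + of_real (c t) =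
      (y - of_real (q t)) * (y - z t) * (y - cnj (z t))"
    using q
  proof eventually_elim
    case (elim t)
    have zz: "z t + cnj (z t) = - of_real (u t)"
      by (simp add: z_def complex_eq_iff)
    have "(sqrt (D t))\<^sup>2 = D t" using elim by simp
    then have zw: "z t * cnj (z t) = of_real (w t)"
      by (simp add: z_def complex_eq_iff D_def power2_eq_square algebra_simps)
    have "c t = - (w t * q t)"
      using elim by (simp add: F_def w_def u_def power2_eq_square power3_eq_cube algebra_simps)
    then have c': "of_real (c t) = - (z t * cnj (z t)) * of_real (q t)" by (simp add: zw)
    have "a t = u t - q t" by (simp add: u_def)
    then have a': "of_real (a t) = - (z t + cnj (z t)) - of_real (q t)" by (simp add: zz)
    have "b t = w t - q t * u t" by (simp add: w_def)
    then have b': "of_real (b t) = z t * cnj (z t) + of_real (q t) * (z t + cnj (z t))" by (simp add: zw zz)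
    show ?case unfolding a' b' c' by (simp add: power2_eq_square power3_eq_cube algebra_simps)
  qed
  with q_lim z_lim show ?thesis by blast
qed

section \<open>Integer cubics with a multiple of companion type\<close>

text \<open>The divisor is the reversal of the minimal real quadratic of \<open>\<omega>\<close>, so it vanishes at
  \<open>1 / \<omega>\<close>; the remainder modulo it is linear with real coefficients and so cannot vanish at a
  nonreal point unless it is zero.\<close>
lemma real_quadratic_dvd:
  fixes P :: "real poly" and \<omega> :: complex
  assumes root: "poly (map_poly of_real P) (1 / \<omega>) = 0" and \<omega>: "Im \<omega> \<noteq> 0"
  shows "[:1, - 2 * Re \<omega>, (cmod \<omega>)\<^sup>2:] dvd P" (is "?Q dvd P")
proof -
  have hom_add: "map_poly of_real (p + q) = map_poly of_real p + (map_poly of_real q :: complex poly)" for p q :: "real poly"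
    by (intro poly_eqI) (simp add: coeff_map_poly)
  have hom_mult: "map_poly of_real (p * q) = map_poly of_real p * (map_poly of_real q :: complex poly)" for p q :: "real poly"
    by (intro poly_eqI) (simp add: coeff_map_poly coeff_mult)
  have nz: "\<omega> \<noteq> 0" using \<omega> by auto
  define R where "R = P mod ?Q"
  have degQ: "degree ?Q = 2" using nz by simp
  have "degree R < 2" unfolding R_def using degree_mod_less[of ?Q P] degQ by auto
  then obtain u v where R: "R = [:u, v:]"
    by (metis degree_eq_zeroE less_2_cases pCons_0_0 degree1_coeffs One_nat_def)
  have "poly (map_poly of_real ?Q) (1 / \<omega>) = (\<omega>\<^sup>2 - (\<omega> + cnj \<omega>) * \<omega> + \<omega> * cnj \<omega>) / \<omega>\<^sup>2"
    using nz by (simp add: Polynomial.map_poly_pCons complex_add_cnj complex_norm_square[symmetric] field_simps power2_eq_square)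
  then have Q0: "poly (map_poly of_real ?Q) (1 / \<omega>) = 0"
    by (simp add: power2_eq_square algebra_simps)
  have "map_poly of_real P = map_poly of_real (P div ?Q) * map_poly of_real ?Q + (map_poly of_real R :: complex poly)"
    unfolding hom_mult[symmetric] hom_add[symmetric] R_def by (simp only: div_mult_mod_eq)
  then have "poly (map_poly of_real P) (1 / \<omega>) = poly (map_poly of_real R) (1 / \<omega>)"
    by (simp only: poly_add poly_mult Q0 mult_zero_right add_0)
  then have "of_real u + of_real v / \<omega> = 0"
    using root by (simp add: R Polynomial.map_poly_pCons)
  moreover have "of_real u * \<omega> + of_real v = (of_real u + of_real v / \<omega>) * \<omega>"
    using nz by (simp add: distrib_right)
  ultimately have "of_real u * \<omega> = - of_real v" by (simp add: eq_neg_iff_add_eq_0)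
  then have "u * Im \<omega> = 0" "u * Re \<omega> = - v" by (simp_all add: complex_eq_iff)
  then have "R = 0" using \<omega> R by simp
  then show ?thesis by (simp add: R_def mod_eq_0_iff_dvd)
qed

text \<open>The sum is \<open>(1 - (r x)\<^sup>M) / (1 - r x)\<close>; its roots are \<open>1 / (r \<zeta>)\<close> for the nontrivial \<open>M\<close>-th roots
  of unity \<open>\<zeta>\<close>, and \<open>1 / \<omega>\<close> is among them.\<close>
lemma cofactor_of_geometric_sum:
  fixes r :: real
  assumes "M \<ge> 3" "0 < r"
  defines "\<omega> \<equiv> of_real r * cis (2 * pi / M)"
  shows "\<exists>G. [:1, - 2 * Re \<omega>, (cmod \<omega>)\<^sup>2:] * G = (\<Sum>k<M. monom (r ^ k) k) \<and> coeff G 0 = 1 \<and> degree G = M - 3"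
proof -
  define H where "H = (\<Sum>k<M. monom (r ^ k) k)"
  have coeff_H: "coeff H k = (if k < M then r ^ k else 0)" for k
    by (simp add: H_def coeff_sum)
  have "2 * pi / M < pi" using \<open>M \<ge> 3\<close> by (simp add: field_simps)
  then have sin: "sin (2 * pi / M) > 0" using \<open>M \<ge> 3\<close> by (intro sin_gt_zero) auto
  then have Im: "Im \<omega> \<noteq> 0" using \<open>r > 0\<close> by (simp add: \<omega>_def)
  define \<xi> where "\<xi> = cnj (cis (2 * pi / M))"
  have r\<omega>: "of_real r * (1 / \<omega>) = \<xi>"
    using \<open>r > 0\<close> by (simp add: \<omega>_def \<xi>_def cis_cnj cis_inverse[symmetric] inverse_eq_divide)
  have "\<xi> ^ M = 1" using \<open>M \<ge> 3\<close> by (simp add: \<xi>_def cis_cnj DeMoivre complex_eq_iff)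
  moreover have "\<xi> \<noteq> 1" using sin by (auto simp: \<xi>_def complex_eq_iff)
  ultimately have "(\<Sum>k<M. \<xi> ^ k) = 0" by (simp add: geometric_sum)
  moreover have "poly (map_poly of_real H) (1 / \<omega>) = (\<Sum>k<M. \<xi> ^ k)"
  proof -
    have "map_poly of_real H = (\<Sum>k<M. monom (of_real (r ^ k) :: complex) k)"
      by (intro poly_eqI) (simp add: coeff_map_poly coeff_H coeff_sum)
    then show ?thesis by (simp add: poly_sum poly_monom flip: r\<omega> power_mult_distrib)
  qed
  ultimately have "[:1, - 2 * Re \<omega>, (cmod \<omega>)\<^sup>2:] dvd H"
    by (intro real_quadratic_dvd Im) simp
  then obtain G where G: "H = [:1, - 2 * Re \<omega>, (cmod \<omega>)\<^sup>2:] * G" by (elim dvdE)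
  have "coeff H (M - 1) \<noteq> 0" using assms by (simp add: coeff_H)
  then have "degree H = M - 1"
    using coeff_H by (intro antisym degree_le le_degree) auto
  moreover have "H \<noteq> 0" using \<open>coeff H (M - 1) \<noteq> 0\<close> by auto
  moreover have "\<omega> \<noteq> 0" using Im by auto
  ultimately have "degree G = M - 3" using \<open>M \<ge> 3\<close>
    by (subst (asm) G, subst (asm) degree_mult_eq) (auto simp: G)
  moreover have "coeff G 0 = 1"
    using coeff_H[of 0] \<open>M \<ge> 3\<close> by (simp add: G coeff_mult)
  ultimately show ?thesis using G unfolding H_def by (intro exI[of _ G]) simp
qed

lemma tendsto_rounded_coefficient:
  assumes "k > 0" and err: "\<And>t. \<bar>n t - real t ^ k * x\<bar> \<le> C"
  shows "(\<lambda>t. n t / real t ^ k) \<longlonglongrightarrow> x"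
proof -
  have "(\<lambda>t. C * (1 / real t) ^ k) \<longlonglongrightarrow> C * 0 ^ k"
    by (intro tendsto_intros lim_1_over_n)
  then have lim: "(\<lambda>t. C * (1 / real t) ^ k) \<longlonglongrightarrow> 0"
    unfolding zero_power[OF \<open>k > 0\<close>] by (simp only: mult_zero_right)
  have "\<forall>\<^sub>F t in sequentially. \<bar>n t / real t ^ k - x\<bar> \<le> C * (1 / real t) ^ k"
    using eventually_gt_at_top[of 0]
  proof eventually_elim
    case (elim t)
    have "n t / real t ^ k - x = (n t - real t ^ k * x) / real t ^ k"
      using elim by (simp add: field_simps)
    then show ?case using err[of t] by (simp add: power_divide abs_divide divide_right_mono)
  qed
  then show ?thesis by (rule tendsto_if_norm_diff_le[OF lim])
qed

lemma rounding_error: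
  fixes x :: real
  assumes "m > 0"
  shows "\<bar>of_int (m * \<lfloor>x / of_int m\<rfloor>) - x\<bar> \<le> of_int m"
proof -
  have m: "of_int m > (0 :: real)" using assms by simp
  have "x / of_int m < of_int \<lfloor>x / of_int m\<rfloor> + 1" by linarith
  then have "x < of_int m * of_int \<lfloor>x / of_int m\<rfloor> + of_int m"
    using m by (simp add: pos_divide_less_eq algebra_simps)
  moreover have "of_int m * of_int \<lfloor>x / of_int m\<rfloor> \<le> x"
    using pos_le_divide_eq[OF m, THEN iffD1, OF of_int_floor_le] by (simp add: mult.commute)
  ultimately show ?thesis using m by simp
qed

text \<open>Polynomials are written in reversed order, as polynomials in \<open>x = 1/y\<close>, so that the coefficient at
  index \<open>k\<close> scales like \<open>t\<^sup>k\<close> when the roots are multiplied by \<open>t\<close>. With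
  \<open>F = (1 - x)(1 - \<omega> x)(1 - cnj \<omega> x)\<close> and the cofactor \<open>G\<close> of the geometric sum,
  \<open>F G = (1 - x)(1 + r x + \<dots> + (r x)\<^sup>M\<^sup>-\<^sup>1)\<close> has strictly negative coefficients at the indices
  \<open>1, \<dots>, M\<close>. Replacing the coefficients of the rescaled \<open>F\<close> and \<open>G\<close> by nearby integers changes
  those of the product only in lower order, so they remain negative for large \<open>t\<close>. Multiplying the
  integer cubic by its integer cofactor thus turns a root of the cubic into a root of
  \<open>y\<^sup>M - \<Sum> d\<^sub>j y\<^sup>M\<^sup>-\<^sup>1\<^sup>-\<^sup>j\<close> with all \<open>d\<^sub>j > 0\<close>.\<close>
lemma rounded_cubics:
  fixes r :: real
  assumes M: "M \<ge> 3" and r: "0 < r" "r < 1"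
  defines "\<omega> \<equiv> of_real r * cis (2 * pi / M)"
  shows "\<exists>a b c :: nat \<Rightarrow> int.
    (\<forall>t. even (a t) \<and> even (b t) \<and> c t mod 4 = 2) \<and>
    (\<lambda>t. a t / real t) \<longlonglongrightarrow> - 1 - 2 * Re \<omega> \<and>
    (\<lambda>t. b t / real t ^ 2) \<longlonglongrightarrow> 2 * Re \<omega> + (cmod \<omega>)\<^sup>2 \<and>
    (\<lambda>t. c t / real t ^ 3) \<longlonglongrightarrow> - (cmod \<omega>)\<^sup>2 \<and>
    (\<forall>\<^sub>F t in sequentially. \<exists>d :: nat \<Rightarrow> int. (\<forall>j<M. d j > 0) \<and>
      (\<forall>p :: real. p > 0 \<longrightarrow> p ^ 3 + a t * p\<^sup>2 + b t * p + c t = 0 \<longrightarrow>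
        p ^ M = (\<Sum>j<M. d j * p ^ (M - 1 - j))))"
proof -
  obtain G where G: "[:1, - 2 * Re \<omega>, (cmod \<omega>)\<^sup>2:] * G = (\<Sum>k<M. monom (r ^ k) k)"
    "coeff G 0 = 1" "degree G = M - 3"
    using cofactor_of_geometric_sum[OF M r(1)] unfolding \<omega>_def by blast
  define F where "F = [:1, - 1 - 2 * Re \<omega>, 2 * Re \<omega> + (cmod \<omega>)\<^sup>2, - (cmod \<omega>)\<^sup>2:]"
  have "F * G = [:1, - 1:] * ([:1, - 2 * Re \<omega>, (cmod \<omega>)\<^sup>2:] * G)"
    unfolding mult.assoc[symmetric] by (simp add: F_def)
  then have FG: "F * G = [:1, - 1:] * (\<Sum>k<M. monom (r ^ k) k)" by (simp only: G(1))
  have FG_neg: "coeff (F * G) k < 0" if "1 \<le> k" "k \<le> M" for k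
  proof -
    obtain l where l: "k = Suc l" using \<open>1 \<le> k\<close> by (cases k) auto
    have "r ^ Suc l < r ^ l" "r ^ l > 0" using r by simp_all
    then show ?thesis using that by (auto simp: FG l coeff_sum coeff_pCons)
  qed
  \<comment> \<open>Rounding to multiples of 2 and to \<open>2 + 4 \<int>\<close> keeps the errors bounded and secures irreducibility.\<close>
  define a where "a t = 2 * \<lfloor>(real t ^ 1 * coeff F 1) / of_int 2\<rfloor>" for t
  define b where "b t = 2 * \<lfloor>(real t ^ 2 * coeff F 2) / of_int 2\<rfloor>" for t
  define c where "c t = 4 * \<lfloor>(real t ^ 3 * coeff F 3) / of_int 4\<rfloor> + 2" for t
  define g where "g t = (\<Sum>j\<le>M - 3. monom \<lfloor>real t ^ j * coeff G j\<rfloor> j)" for t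
  have parity: "even (a t)" "even (b t)" "c t mod 4 = 2" for t
  proof -
    show "even (a t)" "even (b t)" by (simp_all add: a_def b_def)
    show "c t mod 4 = 2" unfolding c_def by presburger
  qed
  have "\<bar>a t - real t ^ 1 * coeff F 1\<bar> \<le> of_int 2" for t
    unfolding a_def by (rule rounding_error) simp
  then have a_lim: "(\<lambda>t. a t / real t ^ 1) \<longlonglongrightarrow> coeff F 1"
    by (intro tendsto_rounded_coefficient) auto
  have "\<bar>b t - real t ^ 2 * coeff F 2\<bar> \<le> of_int 2" for t
    unfolding b_def by (rule rounding_error) simp
  then have b_lim: "(\<lambda>t. b t / real t ^ 2) \<longlonglongrightarrow> coeff F 2"
    by (intro tendsto_rounded_coefficient) auto
  have "\<bar>c t - real t ^ 3 * coeff F 3\<bar> \<le> 6" for t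
    using rounding_error[of 4 "real t ^ 3 * coeff F 3"] unfolding c_def by simp
  then have c_lim: "(\<lambda>t. c t / real t ^ 3) \<longlonglongrightarrow> coeff F 3"
    by (intro tendsto_rounded_coefficient) auto
  define f where "f t = [:1, a t, b t, c t:]" for t
  have f_lim: "(\<lambda>t. coeff (f t) k / real t ^ k) \<longlonglongrightarrow> coeff F k" for k
  proof -
    consider "k = 0" | "k = 1" | "k = 2" | "k = 3" | "k > 3" by linarith
    then show ?thesis
    proof cases
      case 5
      then have "degree F < k" "degree (f t) < k" for t
        by (auto simp: F_def f_def intro: le_less_trans[OF degree_pCons_le])
      then show ?thesis by (simp add: coeff_eq_0)
    qed (use a_lim b_lim c_lim in \<open>simp_all add: f_def F_def numeral_eq_Suc\<close>)
  qed
  have coeff_g: "coeff (g t) k = \<lfloor>real t ^ k * coeff G k\<rfloor>" for t k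
    using G(3) by (auto simp: g_def coeff_sum coeff_eq_0)
  \<comment> \<open>The constant coefficient must be exactly 1, and it is: \<open>G\<close> has constant coefficient 1.\<close>
  have g_lim: "(\<lambda>t. coeff (g t) k / real t ^ k) \<longlonglongrightarrow> coeff G k" for k
  proof (cases "k = 0")
    case False
    have "\<bar>of_int \<lfloor>real t ^ k * coeff G k\<rfloor> - real t ^ k * coeff G k\<bar> \<le> 1" for t by linarith
    then show ?thesis using False unfolding coeff_g by (intro tendsto_rounded_coefficient) auto
  qed (simp add: coeff_g G(2))
  have fg_lim: "(\<lambda>t. coeff (f t * g t) k / real t ^ k) \<longlonglongrightarrow> coeff (F * G) k" for k
  proof -
    have "coeff (f t * g t) k / real t ^ k =
        (\<Sum>i\<le>k. (coeff (f t) i / real t ^ i) * (coeff (g t) (k - i) / real t ^ (k - i)))" for t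
      by (simp add: coeff_mult sum_divide_distrib flip: power_add)
    then show ?thesis unfolding coeff_mult[of F G] by (simp only:) (intro tendsto_intros f_lim g_lim)
  qed
  have "\<forall>\<^sub>F t in sequentially. \<forall>k\<in>{1..M}. coeff (f t * g t) k / real t ^ k < 0"
    by (intro eventually_ball_finite ballI order_tendstoD(2)[OF fg_lim] FG_neg) auto
  then have fg_neg: "\<forall>\<^sub>F t in sequentially. \<forall>k\<in>{1..M}. coeff (f t * g t) k < 0"
  proof eventually_elim
    case (elim t)
    show ?case
    proof
      fix k assume "k \<in> {1..M}"
      with elim have "coeff (f t * g t) k / real t ^ k < 0" by blast
      then show "coeff (f t * g t) k < 0" unfolding divide_less_0_iff by (simp add: not_less)
    qed
  qed
  have expansion: "p ^ M = (\<Sum>j<M. - coeff (f t * g t) (Suc j) * p ^ (M - 1 - j))"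
    if "p > 0" "p ^ 3 + a t * p\<^sup>2 + b t * p + c t = 0" for p :: real and t
  proof -
    have "degree (f t) \<le> 3" by (simp add: f_def)
    moreover have "degree (g t) \<le> M - 3"
      unfolding g_def by (intro degree_sum_le) (auto intro: order_trans[OF degree_monom_le])
    ultimately have deg: "degree (f t * g t) \<le> M"
      using degree_mult_le[of "f t" "g t"] M by linarith
    have hom: "map_poly of_int (f t * g t) = map_poly of_int (f t) * (map_poly of_int (g t) :: real poly)"
      by (intro poly_eqI) (simp add: coeff_map_poly coeff_mult)
    have inv: "p * (1 / p) = 1" using that(1) by simp
    have "poly (map_poly of_int (f t)) (1 / p) =
        (p * (1 / p)) ^ 3 + a t * (1 / p) * (p * (1 / p))\<^sup>2 + b t * (1 / p)\<^sup>2 * (p * (1 / p)) + c t * (1 / p) ^ 3"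
      unfolding inv by (simp add: f_def Polynomial.map_poly_pCons distrib_left power2_eq_square power3_eq_cube)
    also have "\<dots> = (1 / p) ^ 3 * (p ^ 3 + a t * p\<^sup>2 + b t * p + c t)"
      unfolding power_mult_distrib by (simp only: distrib_left power2_eq_square power3_eq_cube mult_ac)
    finally have "poly (map_poly of_int (f t * g t)) (1 / p) = 0"
      using that(2) by (simp add: hom)
    moreover have "poly (map_poly of_int (f t * g t)) (1 / p) = (\<Sum>k\<le>M. coeff (f t * g t) k * (1 / p) ^ k)"
      using deg unfolding poly_altdef
      by (intro sum.mono_neutral_cong_left) (auto simp: coeff_map_poly degree_map_poly intro: coeff_eq_0)
    ultimately have "(\<Sum>k\<le>M. coeff (f t * g t) k * (1 / p) ^ k) = 0" by simp
    then have "0 = p ^ M * (\<Sum>k\<le>M. coeff (f t * g t) k * (1 / p) ^ k)" by simp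
    also have "\<dots> = (\<Sum>k\<le>M. coeff (f t * g t) k * p ^ (M - k))"
      unfolding sum_distrib_left
      using that(1) by (intro sum.cong) (auto simp: power_divide power_diff)
    \<comment> \<open>The product of the reversed polynomials has constant coefficient 1, giving \<open>p\<^sup>M\<close>.\<close>
    also have "\<dots> = p ^ M + (\<Sum>j<M. coeff (f t * g t) (Suc j) * p ^ (M - 1 - j))"
      using G(2) by (subst sum.atMost_shift) (simp add: coeff_mult f_def coeff_g)
    finally show ?thesis by (simp add: sum_negf)
  qed
  from fg_neg have "\<forall>\<^sub>F t in sequentially. \<exists>d :: nat \<Rightarrow> int. (\<forall>j<M. d j > 0) \<and>
      (\<forall>p :: real. p > 0 \<longrightarrow> p ^ 3 + a t * p\<^sup>2 + b t * p + c t = 0 \<longrightarrow>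
        p ^ M = (\<Sum>j<M. d j * p ^ (M - 1 - j)))"
  proof eventually_elim
    case (elim t)
    then show ?case
      using expansion[of _ t] by (intro exI[of _ "\<lambda>j. - coeff (f t * g t) (Suc j)"]) auto
  qed
  moreover have "coeff F 1 = - 1 - 2 * Re \<omega>" "coeff F 2 = 2 * Re \<omega> + (cmod \<omega>)\<^sup>2" "coeff F 3 = - (cmod \<omega>)\<^sup>2"
    by (simp_all add: F_def numeral_eq_Suc)
  ultimately show ?thesis
    using parity a_lim b_lim c_lim by (intro exI[of _ a] exI[of _ b] exI[of _ c]) auto
qed

section \<open>Cubic Perron numbers of large Perron--Frobenius degree\<close>

text \<open>The exact negation of the conclusion of \<open>eigenvalue_of_aperiodic_matrix_near_root_of_unity\<close>, in all
  dimensions up to \<open>N\<close>. The condition is open, and on the unit circle it only says that no power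
  with exponent from 1 to \<open>N\<close> equals 1.\<close>
definition separated_from_roots_of_unity :: "nat \<Rightarrow> complex \<Rightarrow> bool" where
  "separated_from_roots_of_unity N \<mu> \<longleftrightarrow> (\<forall>n\<in>{1..N}. \<forall>m\<in>{1..n}.
     n * sqrt (1 - cmod \<mu> ^ (2 * n)) < cmod (1 - \<mu> ^ m) * cmod \<mu> ^ n)"

lemma eventually_separated_from_roots_of_unity:
  assumes sep: "separated_from_roots_of_unity N \<mu>" and lim: "(f \<longlongrightarrow> \<mu>) F"
  shows "\<forall>\<^sub>F t in F. separated_from_roots_of_unity N (f t)"
  unfolding separated_from_roots_of_unity_def
proof (intro eventually_ball_finite ballI finite_atLeastAtMost)
  fix n m assume "n \<in> {1..N}" "m \<in> {1..n}"
  then have less: "n * sqrt (1 - cmod \<mu> ^ (2 * n)) - cmod (1 - \<mu> ^ m) * cmod \<mu> ^ n < 0"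
    using sep by (simp add: separated_from_roots_of_unity_def)
  have "((\<lambda>t. n * sqrt (1 - cmod (f t) ^ (2 * n)) - cmod (1 - f t ^ m) * cmod (f t) ^ n) \<longlongrightarrow>
      n * sqrt (1 - cmod \<mu> ^ (2 * n)) - cmod (1 - \<mu> ^ m) * cmod \<mu> ^ n) F"
    by (intro tendsto_intros lim)
  from order_tendstoD(2)[OF this less]
  show "\<forall>\<^sub>F t in F. n * sqrt (1 - cmod (f t) ^ (2 * n)) < cmod (1 - f t ^ m) * cmod (f t) ^ n"
    by simp
qed

lemma separated_primitive_root:
  assumes "N < M"
  shows "separated_from_roots_of_unity N (cis (2 * pi / M))"
proof -
  have "cis (2 * pi / M) ^ m \<noteq> 1" if "1 \<le> m" "m \<le> N" for m
  proof
    assume "cis (2 * pi / M) ^ m = 1"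
    then have "cos (m * (2 * pi / M)) = 1" by (simp add: DeMoivre complex_eq_iff)
    then obtain k :: int where k: "m * (2 * pi / M) = of_int k * 2 * pi"
      by (auto simp: cos_one_2pi_int)
    then have "real m = of_int (k * int M)" using assms by (simp add: field_simps)
    then have "int m = k * int M" by linarith
    then have "int M dvd int m" by simp
    then show False using that assms by (auto dest: dvd_imp_le)
  qed
  then show ?thesis by (auto simp: separated_from_roots_of_unity_def)
qed

text \<open>The matrix \<open>A\<close> guarantees that the minimum defining the degree is attained. An attaining matrix
  has \<open>z\<close> among its eigenvalues, which is impossible in dimension at most \<open>N\<close>.\<close>
lemma perron_frobenius_degree_gtI:
  assumes f: "is_min_poly p f" and "p > 0"
    and z: "poly (map_poly of_rat f) z = 0" "separated_from_roots_of_unity N (z / of_real p)"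
    and A: "A \<in> carrier_mat n n" "n > 0" "aperiodic_mat A" "spectral_radius (map_mat complex_of_int A) = p"
  shows "perron_frobenius_degree p > N"
proof -
  define d where "d = perron_frobenius_degree p"
  have "d > 0 \<and> (\<exists>B \<in> carrier_mat d d. aperiodic_mat B \<and> spectral_radius (map_mat complex_of_int B) = p)"
    unfolding d_def perron_frobenius_degree_def by (rule LeastI[of _ n]) (use A in auto)
  then obtain B where B: "d > 0" "B \<in> carrier_mat d d" "aperiodic_mat B" "spectral_radius (map_mat complex_of_int B) = p"
    by blast
  obtain v :: "nat \<Rightarrow> real" where v: "\<And>i. i < d \<Longrightarrow> v i > 0" "\<And>i. i < d \<Longrightarrow> mat_app B v i = p * v i"
    using perron_eigenvector[OF B(2,3,1)] B(4) by auto
  have "mat_app B (\<lambda>i. complex_of_real (v i)) i = of_real p * of_real (v i)" if "i < d" for i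
  proof -
    have "mat_app B (\<lambda>i. complex_of_real (v i)) i = of_real (mat_app B v i)" by (simp add: mat_app_def)
    then show ?thesis using v(2)[OF that] by simp
  qed
  moreover have "complex_of_real (v 0) \<noteq> 0" using v(1)[OF \<open>d > 0\<close>] by simp
  ultimately have "eigenvalue (map_mat complex_of_int B) (of_real p)"
    unfolding eigenvalue_iff_mat_app[OF B(2)] using \<open>d > 0\<close>
    by (intro exI[of _ "\<lambda>i. complex_of_real (v i)"]) auto
  then have "eigenvalue (map_mat complex_of_int B) z"
    using conjugate_is_eigenvalue[OF B(2) f _ z(1)] by blast
  from eigenvalue_of_aperiodic_matrix_near_root_of_unity[OF B(2,3,1,4) \<open>p > 0\<close> this]
  obtain m where m: "m \<in> {1..d}"
    "cmod (1 - (z / of_real p) ^ m) * cmod (z / of_real p) ^ d \<le> d * sqrt (1 - cmod (z / of_real p) ^ (2 * d))"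
    by blast
  have "\<not> d \<le> N"
  proof
    assume "d \<le> N"
    then have "d \<in> {1..N}" using \<open>d > 0\<close> by simp
    then have "d * sqrt (1 - cmod (z / of_real p) ^ (2 * d)) < cmod (1 - (z / of_real p) ^ m) * cmod (z / of_real p) ^ d"
      using z(2) m(1) unfolding separated_from_roots_of_unity_def by blast
    with m(2) show False by linarith
  qed
  then show ?thesis by (simp add: d_def)
qed

theorem corollary1p2:
  fixes N :: nat
  assumes "N > 0"
  shows "\<exists>p :: real. perron_number p \<and> algebraic_degree p = 3 \<and> perron_frobenius_degree p > N"
proof -
  define M where "M = N + 3"
  define \<zeta> where "\<zeta> = cis (2 * pi / M)"
  \<comment> \<open>First move from \<open>\<zeta>\<close> to a point \<open>\<omega> = r \<zeta>\<close> strictly inside the unit disc.\<close>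
  have sep_\<zeta>: "separated_from_roots_of_unity N \<zeta>"
    unfolding \<zeta>_def by (rule separated_primitive_root) (simp add: M_def)
  have "((\<lambda>r. complex_of_real r * \<zeta>) \<longlongrightarrow> of_real 1 * \<zeta>) (at_left 1)"
    by (intro tendsto_intros)
  then have "((\<lambda>r. complex_of_real r * \<zeta>) \<longlongrightarrow> \<zeta>) (at_left 1)" by simp
  from eventually_separated_from_roots_of_unity[OF sep_\<zeta> this]
  have "\<forall>\<^sub>F r in at_left 1. separated_from_roots_of_unity N (of_real r * \<zeta>)" .
  moreover have "\<forall>\<^sub>F r :: real in at_left 1. r \<in> {0<..<1}"
    by (rule eventually_at_left_real) simp
  ultimately have "\<forall>\<^sub>F r in at_left 1. separated_from_roots_of_unity N (of_real r * \<zeta>) \<and> r \<in> {0<..<1}"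
    by (rule eventually_conj)
  then obtain r :: real where r: "separated_from_roots_of_unity N (of_real r * \<zeta>)" "0 < r" "r < 1"
    using eventually_happens'[OF trivial_limit_at_left_real] by fastforce
  define \<omega> where "\<omega> = of_real r * \<zeta>"
  have "M \<ge> 3" by (simp add: M_def)
  have "2 * pi / M < pi" using \<open>M \<ge> 3\<close> by (simp add: field_simps)
  then have "sin (2 * pi / M) > 0" using \<open>M \<ge> 3\<close> by (intro sin_gt_zero) auto
  then have Im: "Im \<omega> > 0" using r(2) by (simp add: \<omega>_def \<zeta>_def)
  have norm_\<omega>: "cmod \<omega> < 1" using r by (simp add: \<omega>_def \<zeta>_def norm_mult)
  obtain a b c :: "nat \<Rightarrow> int" where parity: "\<And>t. even (a t)" "\<And>t. even (b t)" "\<And>t. c t mod 4 = 2"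
    and lims: "(\<lambda>t. a t / real t) \<longlonglongrightarrow> - 1 - 2 * Re \<omega>"
      "(\<lambda>t. b t / real t ^ 2) \<longlonglongrightarrow> 2 * Re \<omega> + (cmod \<omega>)\<^sup>2"
      "(\<lambda>t. c t / real t ^ 3) \<longlonglongrightarrow> - (cmod \<omega>)\<^sup>2"
    and recurrence: "\<forall>\<^sub>F t in sequentially. \<exists>d :: nat \<Rightarrow> int. (\<forall>j<M. d j > 0) \<and>
      (\<forall>p :: real. p > 0 \<longrightarrow> p ^ 3 + a t * p\<^sup>2 + b t * p + c t = 0 \<longrightarrow>
        p ^ M = (\<Sum>j<M. d j * p ^ (M - 1 - j)))"
    using rounded_cubics[OF \<open>M \<ge> 3\<close> r(2,3)] unfolding \<omega>_def \<zeta>_def by blast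
  obtain q z where q: "q \<longlonglongrightarrow> 1" and z: "z \<longlonglongrightarrow> \<omega>"
    and factors: "\<forall>\<^sub>F t in sequentially. \<forall>y. y ^ 3 + of_real (a t / real t) * y\<^sup>2 + of_real (b t / real t ^ 2) * y +
      of_real (c t / real t ^ 3) = (y - of_real (q t)) * (y - z t) * (y - cnj (z t))"
    using cubic_roots_converge[OF lims Im] by blast
  have "(\<lambda>t. z t / of_real (q t)) \<longlonglongrightarrow> \<omega> / of_real 1"
    by (intro tendsto_intros z q) simp
  then have ratio: "(\<lambda>t. z t / of_real (q t)) \<longlonglongrightarrow> \<omega>" by simp
  \<comment> \<open>Then replace the real cubic with roots \<open>1, \<omega>, cnj \<omega>\<close> by integer cubics rescaled by \<open>t\<close>.\<close>
  have "\<forall>\<^sub>F t in sequentially. separated_from_roots_of_unity N (z t / of_real (q t))"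
    using r(1) by (intro eventually_separated_from_roots_of_unity[OF _ ratio]) (simp add: \<omega>_def)
  moreover have "\<forall>\<^sub>F t in sequentially. cmod (z t / of_real (q t)) < 1"
    using order_tendstoD(2)[OF tendsto_norm[OF ratio] norm_\<omega>] .
  moreover have "\<forall>\<^sub>F t in sequentially. q t > 1 / 2"
    by (rule order_tendstoD(1)[OF q]) simp
  ultimately have "\<forall>\<^sub>F t in sequentially. separated_from_roots_of_unity N (z t / of_real (q t)) \<and>
      cmod (z t / of_real (q t)) < 1 \<and> q t > 1 / 2 \<and> t \<ge> 2 \<and>
      (\<forall>y. y ^ 3 + of_real (a t / real t) * y\<^sup>2 + of_real (b t / real t ^ 2) * y +
        of_real (c t / real t ^ 3) = (y - of_real (q t)) * (y - z t) * (y - cnj (z t))) \<and>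
      (\<exists>d :: nat \<Rightarrow> int. (\<forall>j<M. d j > 0) \<and>
        (\<forall>p :: real. p > 0 \<longrightarrow> p ^ 3 + a t * p\<^sup>2 + b t * p + c t = 0 \<longrightarrow>
          p ^ M = (\<Sum>j<M. d j * p ^ (M - 1 - j))))"
    using factors recurrence eventually_ge_at_top[of 2] by (intro eventually_conj)
  then obtain t where t: "separated_from_roots_of_unity N (z t / of_real (q t)) \<and>
      cmod (z t / of_real (q t)) < 1 \<and> q t > 1 / 2 \<and> t \<ge> 2 \<and>
      (\<forall>y. y ^ 3 + of_real (a t / real t) * y\<^sup>2 + of_real (b t / real t ^ 2) * y +
        of_real (c t / real t ^ 3) = (y - of_real (q t)) * (y - z t) * (y - cnj (z t))) \<and>
      (\<exists>d :: nat \<Rightarrow> int. (\<forall>j<M. d j > 0) \<and>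
        (\<forall>p :: real. p > 0 \<longrightarrow> p ^ 3 + a t * p\<^sup>2 + b t * p + c t = 0 \<longrightarrow>
          p ^ M = (\<Sum>j<M. d j * p ^ (M - 1 - j))))"
    using eventually_happens'[OF sequentially_bot] by fast
  note sep = t[THEN conjunct1]
  note norm_less = t[THEN conjunct2, THEN conjunct1]
  have "q t > 1 / 2" "t \<ge> 2" using t by blast+
  note fac = t[THEN conjunct2, THEN conjunct2, THEN conjunct2, THEN conjunct2, THEN conjunct1, rule_format]
  obtain d :: "nat \<Rightarrow> int" where d: "\<And>j. j < M \<Longrightarrow> d j > 0"
      "\<And>p :: real. p > 0 \<Longrightarrow> p ^ 3 + a t * p\<^sup>2 + b t * p + c t = 0 \<Longrightarrow>
        p ^ M = (\<Sum>j<M. d j * p ^ (M - 1 - j))"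
    using t[THEN conjunct2, THEN conjunct2, THEN conjunct2, THEN conjunct2, THEN conjunct2] by blast
  define p where "p = t * q t"
  define l where "l = of_nat t * z t"
  define f where "f = [:of_int (c t), of_int (b t), of_int (a t), 1 :: rat:]"
  have "2 * (1 / 2) \<le> p" unfolding p_def using \<open>t \<ge> 2\<close> \<open>q t > 1 / 2\<close> by (intro mult_mono) auto
  then have "p \<ge> 1" by simp
  have poly_f: "poly (map_poly of_rat f) x = x ^ 3 + of_int (a t) * x\<^sup>2 + of_int (b t) * x + of_int (c t)"
    for x :: "'a :: field_char_0"
    by (simp add: f_def Polynomial.map_poly_pCons algebra_simps power2_eq_square power3_eq_cube)
  have roots: "x ^ 3 + of_int (a t) * x\<^sup>2 + of_int (b t) * x + of_int (c t) = (x - of_real p) * (x - l) * (x - cnj l)"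
    for x :: complex
  proof -
    define T where "T = complex_of_nat t"
    have T: "T \<noteq> 0" using \<open>t \<ge> 2\<close> by (simp add: T_def)
    have "x ^ 3 + of_int (a t) * x\<^sup>2 + of_int (b t) * x + of_int (c t) =
        T ^ 3 * ((x / T) ^ 3 + of_real (a t / real t) * (x / T)\<^sup>2 + of_real (b t / real t ^ 2) * (x / T) + of_real (c t / real t ^ 3))"
      using T by (simp add: T_def[symmetric] field_simps power2_eq_square power3_eq_cube)
    also have "\<dots> = (T * (x / T - of_real (q t))) * (T * (x / T - z t)) * (T * (x / T - cnj (z t)))"
      unfolding fac by (simp add: power3_eq_cube mult_ac)
    also have "\<dots> = (x - of_real p) * (x - l) * (x - cnj l)"
      using T by (simp add: p_def l_def T_def[symmetric] right_diff_distrib) (simp add: T_def)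
    finally show ?thesis .
  qed
  have "complex_of_real (p ^ 3 + a t * p\<^sup>2 + b t * p + c t) = 0"
    using roots[of "of_real p"] by simp
  then have p_root: "p ^ 3 + a t * p\<^sup>2 + b t * p + c t = 0" by (simp only: of_real_eq_0_iff)
  have min_poly: "is_min_poly p f"
    using irreducible_cubic_mod_four[OF parity] p_root
    by (simp add: is_min_poly_def poly_f) (simp add: f_def)
  have ratio_eq: "l / of_real p = z t / of_real (q t)"
    using \<open>t \<ge> 2\<close> by (simp add: l_def p_def)
  have l_less: "cmod l < p"
    using norm_less \<open>p \<ge> 1\<close> unfolding ratio_eq[symmetric] by (simp add: norm_divide)
  have "algebraic_int p"
    unfolding algebraic_int_altdef_ipoly
    by (intro exI[of _ "[:c t, b t, a t, 1:]"])
      (use p_root in \<open>simp add: Polynomial.map_poly_pCons algebra_simps power2_eq_square power3_eq_cube\<close>)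
  moreover have "cmod x < p" if "x \<in> galois_conjugates p - {complex_of_real p}" for x
  proof -
    have "(x - of_real p) * (x - l) * (x - cnj l) = 0"
      using that unfolding galois_conjugates_def min_poly_eqI[OF min_poly] by (auto simp: poly_f roots)
    moreover have "x \<noteq> of_real p" using that by blast
    ultimately have "x = l \<or> x = cnj l" by simp
    then show ?thesis using l_less by auto
  qed
  ultimately have "perron_number p" using \<open>p \<ge> 1\<close> by (simp add: perron_number_def)
  moreover have "algebraic_degree p = 3"
    by (simp add: algebraic_degree_def min_poly_eqI[OF min_poly]) (simp add: f_def)
  moreover have "perron_frobenius_degree p > N"
  proof (rule perron_frobenius_degree_gtI[OF min_poly])
    show "poly (map_poly of_rat f) l = 0" by (simp add: poly_f roots)
    show "separated_from_roots_of_unity N (l / of_real p)" using sep by (simp add: ratio_eq)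
    show "companion_matrix d M \<in> carrier_mat M M" by (simp add: companion_matrix_def)
    show "aperiodic_mat (companion_matrix d M)"
      using d(1) by (intro companion_matrix_aperiodic) (simp_all add: M_def)
    show "spectral_radius (map_mat complex_of_int (companion_matrix d M)) = p"
      using d p_root \<open>p \<ge> 1\<close> by (intro companion_matrix_spectral_radius) (simp_all add: M_def)
  qed (use \<open>p \<ge> 1\<close> in \<open>simp_all add: M_def\<close>)
  ultimately show ?thesis by blast
qed

end
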